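(* For every sufficiently large integer $n$, $f_3(n)\ge 1.973\,n$.
   Context: $f_k(n)$ denotes the maximum size of a set of points chosen from the $n\times n$ integer grid $\{1,\dots,n\}\times\{1,\dots,n\}$ such that every line of the Euclidean plane contains at most $k$ points of the set. *)

theory Defs
  imports "HOL-Analysis.Analysis"
begin

definition grid :: "nat \<Rightarrow> (real \<times> real) set" where
  "grid n = (\<lambda>(i, j). (real i, real j)) ` ({1..n} \<times> {1..n})"

definition is_line :: "(real \<times> real) set \<Rightarrow> bool" where
  "is_line L \<longleftrightarrow> affine L \<and> aff_dim L = 1"

definition at_most_per_line :: "nat \<Rightarrow> (real \<times> real) set \<Rightarrow> bool" where
  "at_most_per_line k S \<longleftrightarrow> (\<forall>L. is_line L \<longrightarrow> card (S \<inter> L) \<le> k)"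

definition max_pts :: "nat \<Rightarrow> nat \<Rightarrow> nat" where
  "max_pts k n = Max {card S | S. S \<subseteq> grid n \<and> at_most_per_line k S}"

lemma finite_grid: "finite (grid n)"
  by (simp add: grid_def)

text \<open>The maximum in the definition of \<open>max_pts\<close> is taken over a finite nonempty set.\<close>

lemma max_pts_set_finite: "finite {card S | S. S \<subseteq> grid n \<and> at_most_per_line k S}"
proof -
  have "{card S | S. S \<subseteq> grid n \<and> at_most_per_line k S} \<subseteq> card ` Pow (grid n)"
    by auto
  then show ?thesis
    using finite_grid finite_subset by blast
qed

lemma max_pts_set_nonempty: "{card S | S. S \<subseteq> grid n \<and> at_most_per_line k S} \<noteq> {}"
proof -
  have "at_most_per_line k {}"
    by (simp add: at_most_per_line_def)
  then show ?thesis by blast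
qed

end

theory Submission
  imports Defs "HOL-Number_Theory.Number_Theory" "HOL-Real_Asymp.Real_Asymp"
begin

text \<open>
  Take a prime \<open>p\<close> and the hyperbola \<open>u * w = 1\<close> modulo \<open>p\<close>, and place translates of each of its
  points by vectors \<open>(i p, j p)\<close> with \<open>0 \<le> i, j < t\<close> into a grid of side \<open>t p\<close>.  A line of primitive
  direction \<open>(a, b)\<close> meets at most two residue classes \<open>u, v\<close> of the hyperbola, and then
  \<open>b u v + a = 0\<close> modulo \<open>p\<close>.  Only the boundedly many directions with \<open>\<bar>a\<bar>, \<bar>b\<bar> < t\<close> can contain two
  translates of the same point.  For these, the discrete logarithms of \<open>u\<close> and \<open>v\<close> add up to one of
  boundedly many constants modulo \<open>p - 1\<close>, and Dirichlet's simultaneous approximation provides a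
  multiplier \<open>q\<close> that makes all of them close to \<open>0\<close> in the circle; colouring \<open>u\<close> by the half circle
  containing \<open>q\<close> times its logarithm gives \<open>u\<close> and \<open>v\<close> different colours, up to a negligible
  proportion of residues.  Hence one may use two different
  patterns of translates for the two colours, and only has to ensure that a pattern line of the
  first and a nearby parallel pattern line of the second never carry more than three cells together.
  Suitable patterns \<open>A, B\<close> with \<open>(\<bar>A\<bar> + \<bar>B\<bar>) / 2 \<ge> 1.975 (t + 1)\<close> exist for \<open>9 \<le> t \<le> 14\<close>; the factor
  \<open>t + 1\<close> instead of \<open>t\<close> leaves room for all \<open>n < (t + 1) p\<close>, so that a prime in \<open>(5x/8, x]\<close> for
  large \<open>x\<close> is enough and the prime number theorem is not needed.
\<close>

section \<open>Primes between \<open>5n/8\<close> and \<open>n\<close>\<close>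

definition psi :: "nat \<Rightarrow> real" where
  "psi n = (\<Sum>d=1..n. mangoldt d)"

lemma psi_mono: "m \<le> n \<Longrightarrow> psi m \<le> psi n"
  unfolding psi_def by (intro sum_mono2) (auto simp: mangoldt_nonneg)

lemma psi_diff:
  assumes "m \<le> n"
  shows "psi n - psi m = (\<Sum>d\<in>{m<..n}. mangoldt d)"
proof -
  have "{1..n} = {1..m} \<union> {m<..n}" using assms by auto
  moreover have "{1..m} \<inter> {m<..n} = {}" by auto
  ultimately show ?thesis unfolding psi_def by (simp add: sum.union_disjoint)
qed

text \<open>Induction adds \<open>ln (Suc n)\<close> as the sum of \<open>mangoldt\<close> over its
  divisors. Terms with \<open>d > n\<close> vanish, so \<open>N\<close> is free and the factorials
  of all \<open>n div k\<close> expand over one common range.\<close>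

lemma ln_fact_eq_sum_mangoldt:
  "n \<le> N \<Longrightarrow> ln (fact n) = (\<Sum>d=1..N. mangoldt d * real (n div d))"
proof (induction n)
  case 0
  then show ?case by simp
next
  case (Suc n)
  have "ln (fact (Suc n) :: real) = ln (real (Suc n)) + ln (fact n)"
    by (simp add: ln_mult)
  also have "ln (real (Suc n)) = (\<Sum>d | d dvd Suc n. mangoldt d)"
    using mangoldt_sum[of "Suc n", where 'a = real] by simp
  also have "\<dots> = (\<Sum>d=1..N. if d dvd Suc n then mangoldt d else 0)"
  proof (intro sum.mono_neutral_cong_left)
    show "{d. d dvd Suc n} \<subseteq> {1..N}"
    proof
      fix d assume "d \<in> {d. d dvd Suc n}"
      then have "0 < d" "d \<le> Suc n" using dvd_pos_nat[of "Suc n" d] dvd_imp_le[of d "Suc n"] by auto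
      then show "d \<in> {1..N}" using Suc.prems by simp
    qed
  qed auto
  also have "ln (fact n) = (\<Sum>d=1..N. mangoldt d * real (n div d))"
    using Suc by simp
  also have "(\<Sum>d=1..N. if d dvd Suc n then mangoldt d else 0) + (\<Sum>d=1..N. mangoldt d * real (n div d))
      = (\<Sum>d=1..N. mangoldt d * real (Suc n div d) :: real)"
    unfolding sum.distrib[symmetric]
  proof (intro sum.cong refl)
    fix d assume "d \<in> {1..N}"
    have "Suc n div d = n div d + (if d dvd Suc n then 1 else 0)"
      by (simp only: div_Suc dvd_eq_mod_eq_0 split: if_split) simp
    then show "(if d dvd Suc n then mangoldt d else 0) + mangoldt d * real (n div d)
        = (mangoldt d * real (Suc n div d) :: real)"
      by (simp add: distrib_left)
  qed
  finally show ?case .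
qed

text \<open>An error of order \<open>ln n\<close> is harmless, so crude Stirling bounds suffice. The
  induction step here is \<open>n * (ln (n + 1) - ln n) \<le> 1\<close>; for
  \<open>ln_fact_upper\<close> it is \<open>1 \<le> (n + 1) * (ln (n + 1) - ln n)\<close>.\<close>

lemma ln_fact_lower: "0 < n \<Longrightarrow> real n * ln (real n) - real n \<le> ln (fact n)"
proof (induction n rule: nat_induct_non_zero)
  case 1
  then show ?case by simp
next
  case (Suc n)
  have "ln (1 + 1 / real n) \<le> 1 / real n"
    using Suc by (intro ln_add_one_self_le_self) auto
  moreover have "ln (1 + 1 / real n) = ln (real (Suc n)) - ln (real n)"
  proof -
    have "1 + 1 / real n = real (Suc n) / real n" using Suc by (simp add: field_simps)
    then show ?thesis using Suc by (simp add: ln_div del: of_nat_Suc)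
  qed
  ultimately have "ln (real (Suc n)) - ln (real n) \<le> 1 / real n" by simp
  then have "real n * (ln (real (Suc n)) - ln (real n)) \<le> 1"
    using Suc by (simp only: pos_le_divide_eq of_nat_0_less_iff mult.commute)
  moreover have "ln (fact (Suc n) :: real) = ln (real (Suc n)) + ln (fact n)"
    by (simp add: ln_mult)
  ultimately show ?case using Suc.IH by (simp add: algebra_simps del: fact_Suc)
qed

lemma ln_fact_upper: "0 < n \<Longrightarrow> ln (fact n) \<le> real n * ln (real n) - real n + ln (real n) + 1"
proof (induction n rule: nat_induct_non_zero)
  case 1
  then show ?case by simp
next
  case (Suc n)
  have "ln (1 - 1 / real (Suc n)) \<le> - (1 / real (Suc n))"
    using Suc ln_le_minus_one[of "1 - 1 / real (Suc n)"] by simp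
  moreover have "ln (1 - 1 / real (Suc n)) = ln (real n) - ln (real (Suc n))"
  proof -
    have "1 - 1 / real (Suc n) = real n / real (Suc n)" by (simp add: divide_simps)
    then show ?thesis using Suc by (simp add: ln_div del: of_nat_Suc)
  qed
  ultimately have "1 / real (Suc n) \<le> ln (real (Suc n)) - ln (real n)" by simp
  then have "1 \<le> real (Suc n) * (ln (real (Suc n)) - ln (real n))"
    by (simp only: pos_divide_le_eq of_nat_0_less_iff zero_less_Suc mult.commute)
  moreover have "ln (fact (Suc n) :: real) = ln (real (Suc n)) + ln (fact n)"
    by (simp add: ln_mult)
  ultimately show ?case using Suc.IH by (simp add: algebra_simps del: fact_Suc)
qed

lemma x_ln_x_minus_x_mono:
  assumes "1 \<le> x" "x \<le> y"
  shows "x * ln x - x \<le> y * ln y - (y::real)"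
proof (rule DERIV_nonneg_imp_nondecreasing[OF assms(2), where f = "\<lambda>x. x * ln x - x"])
  fix z assume "x \<le> z" "z \<le> y"
  then show "\<exists>D. ((\<lambda>x. x * ln x - x) has_real_derivative D) (at z) \<and> 0 \<le> D"
    using assms by (intro exI[of _ "ln z"]) (auto intro!: derivative_eq_intros)
qed

text \<open>With \<open>m = n div k\<close> one has \<open>m \<le> x \<le> m + 1\<close>. By
  monotonicity of \<open>x * ln x - x\<close>, the upper Stirling bound at \<open>m\<close> and the
  lower one at \<open>m + 1\<close> enclose the main term at \<open>x\<close>.\<close>

lemma ln_fact_div_approx:
  assumes "0 < k" "k \<le> n"
  defines "x \<equiv> real n / real k"
  shows "\<bar>ln (fact (n div k)) - (x * ln x - x)\<bar> \<le> ln (real n + 1) + 1"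
proof -
  let ?m = "n div k"
  have m: "1 \<le> ?m" using assms by (simp add: Suc_leI div_greater_zero_iff)
  have x: "1 \<le> x" "x \<le> real n" using assms by (auto simp: field_simps)
  have mx: "real ?m \<le> x" unfolding x_def by (rule of_nat_div_le_of_nat)
  have "n < k * Suc ?m" using assms by (simp add: dividend_less_times_div)
  then have "real n < real k * real (Suc ?m)" by (metis of_nat_less_iff of_nat_mult)
  then have xm: "x \<le> real (Suc ?m)" unfolding x_def
    using assms by (simp add: field_simps)
  have "ln (fact ?m) \<le> real ?m * ln (real ?m) - real ?m + ln (real ?m) + 1"
    using ln_fact_upper m by simp
  also have "real ?m * ln (real ?m) - real ?m \<le> x * ln x - x"
    using x_ln_x_minus_x_mono m mx by simp
  also have "ln (real ?m) \<le> ln (real n + 1)" using m mx x by simp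
  finally have 1: "ln (fact ?m) \<le> x * ln x - x + ln (real n + 1) + 1" by simp
  have "x * ln x - x \<le> real (Suc ?m) * ln (real (Suc ?m)) - real (Suc ?m)"
    using x_ln_x_minus_x_mono x xm by blast
  also have "\<dots> \<le> ln (fact (Suc ?m))" by (rule ln_fact_lower) simp
  also have "\<dots> = ln (real (Suc ?m)) + ln (fact ?m)" by (simp add: ln_mult)
  also have "ln (real (Suc ?m)) \<le> ln (real n + 1)" using mx x by simp
  finally show ?thesis using 1 x by (simp add: abs_le_iff)
qed

text \<open>With \<open>h x = x * ln x - x\<close>, the combination
  \<open>h n - h (n/2) - h (n/3) - h (n/6)\<close> is this constant times \<open>n\<close>: as 1 =
  1/2 + 1/3 + 1/6, all other terms cancel.\<close>

definition cheb_const :: real where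
  "cheb_const = ln 2 / 2 + ln 3 / 3 + ln 6 / 6"

lemma cheb_const_pos: "0 < cheb_const"
  unfolding cheb_const_def by (intro add_pos_pos divide_pos_pos) auto

text \<open>
  The coefficient of \<open>mangoldt d\<close> in \<open>T(n) - T(n/2) - T(n/3) - T(n/6)\<close>, where \<open>T(x) = ln (x!)\<close> and
  \<open>y = n div d\<close>.  It is \<open>1\<close> for \<open>1 \<le> y < 5\<close>, and since \<open>1 - 1/2 - 1/3 - 1/6 = 0\<close> it is periodic
  and stays between \<open>0\<close> and \<open>2\<close>.
\<close>

definition cheb_coeff :: "nat \<Rightarrow> nat" where
  "cheb_coeff y = y - y div 2 - y div 3 - y div 6"

lemma real_cheb_coeff:
  "real (cheb_coeff y) = real y - real (y div 2) - real (y div 3) - real (y div 6)"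
proof -
  have "y div 2 + y div 3 + y div 6 \<le> y" by linarith
  then show ?thesis unfolding cheb_coeff_def by linarith
qed

text \<open>The sum is a signed combination of four log factorials, each within
  \<open>ln (n + 1) + 1\<close> of its Stirling main term; \<open>6 \<le> n\<close> lets this apply
  to \<open>n div 6\<close>.\<close>

lemma cheb_sum_approx:
  assumes "6 \<le> n"
  shows "\<bar>(\<Sum>d=1..n. mangoldt d * real (cheb_coeff (n div d))) - cheb_const * real n\<bar>
           \<le> 4 * (ln (real n + 1) + 1)"
proof -
  let ?T = "\<lambda>k. ln (fact (n div k)) :: real"
  let ?h = "\<lambda>k. real n / k * ln (real n / k) - real n / k"
  have T: "?T k = (\<Sum>d=1..n. mangoldt d * real (n div d div k))" for k
  proof -
    have "n div k div d = n div d div k" for d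
      by (metis div_mult2_eq mult.commute)
    then show ?thesis by (simp add: ln_fact_eq_sum_mangoldt[of "n div k" n])
  qed
  have S: "(\<Sum>d=1..n. mangoldt d * real (cheb_coeff (n div d))) = ?T 1 - ?T 2 - ?T 3 - ?T 6"
    unfolding T by (simp add: real_cheb_coeff algebra_simps sum.distrib sum_subtractf)
  have L: "ln (real n / 2) = ln (real n) - ln 2" "ln (real n / 3) = ln (real n) - ln 3"
    "ln (real n / 6) = ln (real n) - ln 6"
    using assms by (simp_all add: ln_div)
  have H: "?h 1 - ?h 2 - ?h 3 - ?h 6 = cheb_const * real n"
    unfolding L cheb_const_def by (simp add: field_simps)
  have B: "\<bar>?T k - ?h k\<bar> \<le> ln (real n + 1) + 1" if "k \<in> {1, 2, 3, 6}" for k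
    using ln_fact_div_approx[of k n] that assms by auto
  have comb: "\<bar>s - c\<bar> \<le> 4 * l"
    if "s = a1 - a2 - a3 - a4" "h1 - h2 - h3 - h4 = c"
      "\<bar>a1 - h1\<bar> \<le> l" "\<bar>a2 - h2\<bar> \<le> l" "\<bar>a3 - h3\<bar> \<le> l" "\<bar>a4 - h4\<bar> \<le> l"
    for s c l a1 a2 a3 a4 h1 h2 h3 h4 :: real
    using that unfolding abs_le_iff by linarith
  show ?thesis
    using B[of 1] B[of 2] B[of 3] B[of 6] by (intro comb[OF S H]) simp_all
qed

text \<open>For \<open>n div 6 < d \<le> n\<close> the quotient \<open>n div d\<close> is between 1
  and 5, where the coefficient is at least 1; the remaining terms are nonnegative.\<close>

lemma psi_div6_le_cheb_sum:
  "psi n - psi (n div 6) \<le> (\<Sum>d=1..n. mangoldt d * real (cheb_coeff (n div d)))"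
proof -
  have "psi n - psi (n div 6) = (\<Sum>d\<in>{n div 6<..n}. mangoldt d)"
    by (intro psi_diff) simp
  also have "\<dots> \<le> (\<Sum>d\<in>{n div 6<..n}. mangoldt d * real (cheb_coeff (n div d)))"
  proof (intro sum_mono)
    fix d assume d: "d \<in> {n div 6<..n}"
    then have "n div d < 6" by (simp add: div_less_iff_less_mult)
    moreover have "1 \<le> n div d" using d by (simp add: Suc_leI div_greater_zero_iff)
    ultimately have "n div d \<in> {1, 2, 3, 4, 5}" by auto
    then have "1 \<le> cheb_coeff (n div d)" unfolding cheb_coeff_def by auto
    then show "mangoldt d \<le> mangoldt d * real (cheb_coeff (n div d))"
      using mult_left_mono[of 1 "real (cheb_coeff (n div d))" "mangoldt d"] mangoldt_nonneg
      by simp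
  qed
  also have "\<dots> \<le> (\<Sum>d=1..n. mangoldt d * real (cheb_coeff (n div d)))"
    by (intro sum_mono2) (auto simp: mangoldt_nonneg)
  finally show ?thesis .
qed

text \<open>The coefficient never exceeds 2, and it is at most 1 when \<open>n div d < 5\<close>,
  that is, when \<open>d > n div 5\<close>.\<close>

lemma cheb_sum_le_psi:
  "(\<Sum>d=1..n. mangoldt d * real (cheb_coeff (n div d))) \<le> psi n + psi (n div 5)"
proof -
  have "(\<Sum>d=1..n. mangoldt d * real (cheb_coeff (n div d)))
      \<le> (\<Sum>d=1..n. mangoldt d + (if d \<le> n div 5 then mangoldt d else 0))"
  proof (intro sum_mono)
    fix d assume d: "d \<in> {1..n}"
    let ?c = "cheb_coeff (n div d)"
    have "?c \<le> (if d \<le> n div 5 then 2 else 1)"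
    proof (cases "d \<le> n div 5")
      case False
      then have "n div d < 5" using d by (simp add: div_less_iff_less_mult)
      then show ?thesis using False unfolding cheb_coeff_def by auto
    next
      case True
      then show ?thesis unfolding cheb_coeff_def by simp
    qed
    then have "mangoldt d * real ?c \<le> mangoldt d * real (if d \<le> n div 5 then 2 else 1)"
      by (intro mult_left_mono) (auto simp: mangoldt_nonneg split: if_splits)
    then show "mangoldt d * real ?c \<le> mangoldt d + (if d \<le> n div 5 then mangoldt d else 0)"
      by (auto split: if_splits)
  qed
  also have "\<dots> = psi n + (\<Sum>d=1..n. if d \<le> n div 5 then mangoldt d else 0)"
    by (simp add: psi_def sum.distrib)
  also have "(\<Sum>d=1..n. if d \<le> n div 5 then mangoldt d else 0) = psi (n div 5)"
    unfolding psi_def by (intro sum.mono_neutral_cong_right) auto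
  finally show ?thesis .
qed

text \<open>Iterating \<open>psi n \<le> psi (n div 6) + c n + o(n)\<close> gives the geometric
  factor 1 + 1/6 + 1/36 + ... = 6/5. The induction absorbs an error of up to
  \<open>5/6 * \<epsilon> * n\<close> per step.\<close>

lemma psi_upper:
  assumes "0 < \<epsilon>"
  obtains C where "\<And>n. psi n \<le> (6 / 5 * cheb_const + \<epsilon>) * real n + C"
proof -
  have "\<forall>\<^sub>F n in sequentially. 4 * (ln (real n + 1) + 1) \<le> 5 / 6 * \<epsilon> * real n"
    using assms by real_asymp
  then obtain n0 where n0: "\<And>n. n0 \<le> n \<Longrightarrow> 4 * (ln (real n + 1) + 1) \<le> 5 / 6 * \<epsilon> * real n"
    by (auto simp: eventually_sequentially)
  define K where "K = 6 / 5 * cheb_const + \<epsilon>"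
  have K: "0 < K" using assms cheb_const_pos by (simp add: K_def)
  have "psi n \<le> K * real n + psi (max n0 6)" for n
  proof (induction n rule: less_induct)
    case (less n)
    show ?case
    proof (cases "n \<le> max n0 6")
      case True
      then show ?thesis using psi_mono[OF True] K by (simp add: add_increasing)
    next
      case False
      then have n: "6 \<le> n" "n0 \<le> n" by auto
      have "psi n \<le> psi (n div 6) + cheb_const * real n + 4 * (ln (real n + 1) + 1)"
        using psi_div6_le_cheb_sum[of n] cheb_sum_approx[OF n(1)] by linarith
      also have "psi (n div 6) \<le> K * real (n div 6) + psi (max n0 6)"
        using less.IH[of "n div 6"] n by simp
      also have "K * real (n div 6) \<le> K * (real n / 6)"
        using K of_nat_div_le_of_nat[of n 6, where 'a = real] by (intro mult_left_mono) auto
      also have "4 * (ln (real n + 1) + 1) \<le> 5 / 6 * \<epsilon> * real n" by (rule n0[OF n(2)])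
      finally show ?thesis by (simp add: K_def field_simps)
    qed
  qed
  then show ?thesis using that unfolding K_def by blast
qed

text \<open>Only proper powers \<open>q ^ k\<close> with \<open>k \<ge> 2\<close> contribute, so
  \<open>q \<le> sqrt n\<close> and \<open>k \<le> log 2 n\<close>; each term is at most
  \<open>ln n\<close>.\<close>

lemma psi_diff_without_primes:
  assumes "m \<le> n" "0 < n" "\<And>p. prime p \<Longrightarrow> m < p \<Longrightarrow> \<not> p \<le> n"
  shows "psi n - psi m \<le> (sqrt (real n) + 1) * (log 2 (real n) + 1) * ln (real n)"
proof -
  define P where "P = {d \<in> {m<..n}. primepow d}"
  define Q where "Q = {..nat \<lfloor>sqrt (real n)\<rfloor>} \<times> {..nat \<lfloor>log 2 (real n)\<rfloor>}"
  have log: "0 \<le> log 2 (real n)" using assms by simp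
  have "P \<subseteq> (\<lambda>(q, k). q ^ k) ` Q"
  proof
    fix d assume "d \<in> P"
    then have d: "m < d" "d \<le> n" "primepow d" by (auto simp: P_def)
    then obtain q k where qk: "prime q" "0 < k" "d = q ^ k" by (auto simp: primepow_def)
    have "k \<noteq> 1" using assms(3) qk d by auto
    then have "q ^ 2 \<le> q ^ k" using qk prime_ge_1_nat by (intro power_increasing) auto
    then have "real (q ^ 2) \<le> real n" using qk d by simp
    then have "real q \<le> sqrt (real n)" by (intro real_le_rsqrt) simp
    then have "q \<le> nat \<lfloor>sqrt (real n)\<rfloor>" by (simp add: le_nat_floor)
    moreover have "2 ^ k \<le> q ^ k" using qk prime_ge_2_nat by (intro power_mono) auto
    then have "real (2 ^ k) \<le> real n" using qk d by (simp only: of_nat_le_iff)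
    then have "(2::real) ^ k \<le> real n" by simp
    then have "real k \<le> log 2 (real n)"
      using assms(2) by (simp add: le_log_iff powr_realpow)
    then have "k \<le> nat \<lfloor>log 2 (real n)\<rfloor>" by (simp add: le_nat_floor)
    ultimately show "d \<in> (\<lambda>(q, k). q ^ k) ` Q" using qk by (force simp: Q_def)
  qed
  then have "card P \<le> card Q"
    using surj_card_le[of Q P "\<lambda>(q, k). q ^ k"] by (simp add: Q_def)
  then have card: "real (card P) \<le> (sqrt (real n) + 1) * (log 2 (real n) + 1)"
  proof -
    have "real (card Q) = (real (nat \<lfloor>sqrt (real n)\<rfloor>) + 1) * (real (nat \<lfloor>log 2 (real n)\<rfloor>) + 1)"
      by (simp add: Q_def algebra_simps)
    also have "\<dots> \<le> (sqrt (real n) + 1) * (log 2 (real n) + 1)"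
      using log by (intro mult_mono add_mono of_nat_floor) auto
    finally show ?thesis using \<open>card P \<le> card Q\<close> by linarith
  qed
  have "psi n - psi m \<le> real (card P) * ln (real n)"
  proof -
    have "psi n - psi m = (\<Sum>d\<in>P. mangoldt d)"
      unfolding psi_diff[OF assms(1)] P_def
      by (intro sum.mono_neutral_right) (auto simp: mangoldt_def)
    also have "\<dots> \<le> real (card P) * ln (real n)"
    proof (intro sum_bounded_above)
      fix d assume "d \<in> P"
      then have "0 < d" "d \<le> n" by (auto simp: P_def)
      then show "mangoldt d \<le> ln (real n)"
        using mangoldt_le[of d] by (meson ln_mono of_nat_0_less_iff of_nat_le_iff order_trans)
    qed
    finally show ?thesis .
  qed
  also have "\<dots> \<le> (sqrt (real n) + 1) * (log 2 (real n) + 1) * ln (real n)"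
    using card assms(2) by (intro mult_right_mono) auto
  finally show ?thesis .
qed

text \<open>
  With \<open>c\<close> for \<open>cheb_const\<close>: without such primes, \<open>c n \<le> psi (5n/8) + psi (n/5) + o(n)\<close>, which
  contradicts \<open>psi x \<le> (6/5 + 1/100) c x + O(1)\<close> because \<open>(6/5 + 1/100) (5/8 + 1/5) < 1\<close>.
\<close>

lemma eventually_prime_between:
  "\<forall>\<^sub>F n in sequentially. \<exists>p. prime p \<and> 5 * n < 8 * p \<and> p \<le> n"
proof -
  define c where "c = cheb_const"
  have c: "0 < c" by (simp add: c_def cheb_const_pos)
  obtain C where C: "\<And>n. psi n \<le> (6 / 5 * c + c / 100) * real n + C"
    using psi_upper[of "c / 100"] c unfolding c_def by auto
  define R where "R n = 2 * C + 4 * (ln (real n + 1) + 1)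
    + (sqrt (real n) + 1) * (log 2 (real n) + 1) * ln (real n)" for n
  have "(\<lambda>n. R n / real n) \<longlonglongrightarrow> 0"
    unfolding R_def by real_asymp
  then have "\<forall>\<^sub>F n in sequentially. R n / real n < 7 / 4000 * c"
    using c by (intro order_tendstoD) auto
  then show ?thesis
    using eventually_ge_at_top[of 6]
  proof eventually_elim
    case (elim n)
    show ?case
    proof (rule ccontr)
      assume *: "\<not> ?thesis"
      define m where "m = 5 * n div 8"
      have "\<not> p \<le> n" if "prime p" "m < p" for p
        using * that unfolding m_def by (auto simp: div_less_iff_less_mult mult.commute)
      then have "psi n - psi m \<le> (sqrt (real n) + 1) * (log 2 (real n) + 1) * ln (real n)"
        using elim by (intro psi_diff_without_primes) (auto simp: m_def)
      moreover have "c * real n - 4 * (ln (real n + 1) + 1) \<le> psi n + psi (n div 5)"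
        using cheb_sum_approx[of n] cheb_sum_le_psi[of n] elim unfolding c_def by linarith
      moreover have "psi m \<le> (121 / 100 * c) * (5 / 8 * real n) + C"
      proof -
        have "(121 / 100 * c) * real m \<le> (121 / 100 * c) * (5 / 8 * real n)"
          using c of_nat_div_le_of_nat[of "5 * n" 8, where 'a = real] by (intro mult_left_mono) (auto simp: m_def)
        then show ?thesis using C[of m] by (simp add: field_simps)
      qed
      moreover have "psi (n div 5) \<le> (121 / 100 * c) * (1 / 5 * real n) + C"
      proof -
        have "(121 / 100 * c) * real (n div 5) \<le> (121 / 100 * c) * (1 / 5 * real n)"
          using c of_nat_div_le_of_nat[of n 5, where 'a = real] by (intro mult_left_mono) auto
        then show ?thesis using C[of "n div 5"] by (simp add: field_simps)
      qed
      \<comment> \<open>The slack is 1 - 121/100 * (5/8 + 1/5) = 7/4000.\<close>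
      moreover have "R n < 7 / 4000 * c * real n"
        using elim by (simp add: field_simps)
      ultimately show False unfolding R_def by (simp add: field_simps)
    qed
  qed
qed

section \<open>Separating the end points of chords\<close>

lemma card_nat_near_real_le:
  assumes "0 \<le> \<rho>"
  shows "finite {i::nat. \<bar>real i - c\<bar> \<le> \<rho>}" "real (card {i::nat. \<bar>real i - c\<bar> \<le> \<rho>}) \<le> 2 * \<rho> + 1"
proof -
  let ?S = "{i::nat. \<bar>real i - c\<bar> \<le> \<rho>}"
  have "int ` ?S \<subseteq> {\<lceil>c - \<rho>\<rceil>..\<lfloor>c + \<rho>\<rfloor>}"
    by (auto simp: abs_le_iff ceiling_le_iff le_floor_iff)
  then have fin: "finite (int ` ?S)" and card: "card (int ` ?S) \<le> nat (\<lfloor>c + \<rho>\<rfloor> - \<lceil>c - \<rho>\<rceil> + 1)"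
    using card_mono[of "{\<lceil>c - \<rho>\<rceil>..\<lfloor>c + \<rho>\<rfloor>}" "int ` ?S"] finite_subset by auto
  show "finite ?S" using fin by (rule finite_imageD) simp
  have "real (card ?S) \<le> real (nat (\<lfloor>c + \<rho>\<rfloor> - \<lceil>c - \<rho>\<rceil> + 1))" using card by (simp add: card_image)
  also have "\<dots> \<le> 2 * \<rho> + 1"
    using assms of_int_floor_le[of "c + \<rho>"] le_of_int_ceiling[of "c - \<rho>"]
    by (cases "0 \<le> \<lfloor>c + \<rho>\<rfloor> - \<lceil>c - \<rho>\<rceil> + 1") (simp, linarith, simp)
  finally show "real (card ?S) \<le> 2 * \<rho> + 1" .
qed

text \<open>Scaling by \<open>N / (2 * q)\<close> puts \<open>i\<close> within \<open>\<rho>\<close>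
  of a multiple of \<open>N / (2 * q)\<close>. As \<open>2 * \<delta> < 1\<close>, only the
  \<open>2 * q + 1\<close> values \<open>j\<close> from \<open>0\<close> to \<open>2 * q\<close>
  occur, each allowing at most \<open>2 * \<rho> + 1\<close> integers.\<close>

lemma card_near_half_integers_le:
  fixes q :: int and N :: nat
  assumes "0 < q" "0 < N" "0 \<le> \<delta>" "\<delta> < 1/2"
  shows "real (card {i. i < N \<and> (\<exists>j::int. \<bar>2 * of_int q * real i / real N - of_int j\<bar> \<le> 2 * \<delta>)})
           \<le> 6 * \<delta> * real N + 2 * of_int q + 1" (is "real (card ?S) \<le> _")
proof -
  define \<rho> where "\<rho> = \<delta> * real N / of_int q"
  define I where "I j = {i::nat. \<bar>real i - of_int j * real N / (2 * of_int q)\<bar> \<le> \<rho>}" for j :: int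
  have \<rho>: "0 \<le> \<rho>" using assms by (simp add: \<rho>_def)
  have "?S \<subseteq> (\<Union>j\<in>{0..2*q}. I j)"
  proof
    fix i assume "i \<in> ?S"
    then obtain j :: int where i: "i < N" and j: "\<bar>2 * of_int q * real i / real N - of_int j\<bar> \<le> 2 * \<delta>"
      by auto
    have w: "0 \<le> 2 * of_int q * real i / real N" "2 * of_int q * real i / real N < 2 * of_int q"
      using assms i by (auto simp: field_simps)
    have "-1 < real_of_int j \<and> real_of_int j < 2 * of_int q + 1"
      if "0 \<le> w" "w < 2 * of_int q" "\<bar>w - of_int j\<bar> \<le> 2 * \<delta>" for w
      using that assms(4) by (auto simp: abs_le_iff)
    from this[OF w j] have "j \<in> {0..2*q}" by auto
    moreover have "real i - of_int j * real N / (2 * of_int q)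
        = (2 * of_int q * real i / real N - of_int j) * (real N / (2 * of_int q))"
      using assms by (simp add: field_simps)
    then have "\<bar>real i - of_int j * real N / (2 * of_int q)\<bar>
        = \<bar>2 * of_int q * real i / real N - of_int j\<bar> * (real N / (2 * of_int q))"
      using assms by (simp add: abs_mult)
    then have "i \<in> I j"
      using mult_right_mono[OF j, of "real N / (2 * of_int q)"] assms
      by (simp add: I_def \<rho>_def)
    ultimately show "i \<in> (\<Union>j\<in>{0..2*q}. I j)" by blast
  qed
  then have "card ?S \<le> (\<Sum>j\<in>{0..2*q}. card (I j))"
  proof (intro order_trans[OF card_mono card_UN_le])
    show "finite (\<Union>j\<in>{0..2*q}. I j)"
      using card_nat_near_real_le(1)[OF \<rho>] unfolding I_def by blast
  qed simp_all
  then have "real (card ?S) \<le> (\<Sum>j\<in>{0..2*q}. real (card (I j)))"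
    unfolding of_nat_sum[symmetric] of_nat_le_iff .
  also have "\<dots> \<le> of_nat (card {0..2*q}) * (2 * \<rho> + 1)"
    using card_nat_near_real_le(2)[OF \<rho>] unfolding I_def by (intro sum_bounded_above) auto
  also have "\<dots> = (2 * of_int q + 1) * (2 * \<rho> + 1)" using assms by simp
  also have "\<dots> = 4 * \<delta> * real N + 2 * \<delta> * real N / of_int q + 2 * of_int q + 1"
    using assms by (simp add: \<rho>_def field_simps)
  also have "2 * \<delta> * real N / of_int q \<le> 2 * \<delta> * real N / 1"
    using assms by (intro divide_left_mono) auto
  finally show ?thesis by simp
qed

lemma not_half_colored_imp_near:
  fixes w :: real
  assumes "\<not> (\<delta> < frac w \<and> frac w < 1/2 - \<delta>)" "\<not> (1/2 + \<delta> < frac w \<and> frac w < 1 - \<delta>)"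
  shows "\<exists>j::int. \<bar>2 * w - of_int j\<bar> \<le> 2 * \<delta>"
proof -
  have w: "w = of_int \<lfloor>w\<rfloor> + frac w" "0 \<le> frac w" "frac w < 1"
    by (simp_all add: frac_def) linarith+
  consider "frac w \<le> \<delta>" | "1/2 - \<delta> \<le> frac w" "frac w \<le> 1/2 + \<delta>" | "1 - \<delta> \<le> frac w"
    using assms by linarith
  then show ?thesis
  proof cases
    case 1
    then have "\<bar>2 * w - of_int (2 * \<lfloor>w\<rfloor>)\<bar> \<le> 2 * \<delta>"
      using w unfolding of_int_mult of_int_add of_int_numeral of_int_1 by linarith
    then show ?thesis by blast
  next
    case 2
    then have "\<bar>2 * w - of_int (2 * \<lfloor>w\<rfloor> + 1)\<bar> \<le> 2 * \<delta>"
      using w unfolding of_int_mult of_int_add of_int_numeral of_int_1 by linarith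
    then show ?thesis by blast
  next
    case 3
    then have "\<bar>2 * w - of_int (2 * \<lfloor>w\<rfloor> + 2)\<bar> \<le> 2 * \<delta>"
      using w unfolding of_int_mult of_int_add of_int_numeral of_int_1 by linarith
    then show ?thesis by blast
  qed
qed

text \<open>Modulo 1, twice an arc of length 1/2 covers the circle once. Shrinking the arc by
  \<open>\<delta>\<close> at both ends therefore keeps the sum more than \<open>2 * \<delta>\<close>
  away from every integer.\<close>

lemma half_colored_add_not_near:
  fixes x y :: real and z :: int
  assumes "(\<delta> < frac x \<and> frac x < 1/2 - \<delta> \<and> \<delta> < frac y \<and> frac y < 1/2 - \<delta>) \<or>
    (1/2 + \<delta> < frac x \<and> frac x < 1 - \<delta> \<and> 1/2 + \<delta> < frac y \<and> frac y < 1 - \<delta>)"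
    and "\<epsilon> \<le> 2 * \<delta>"
  shows "\<not> \<bar>x + y - of_int z\<bar> \<le> \<epsilon>"
proof
  assume *: "\<bar>x + y - of_int z\<bar> \<le> \<epsilon>"
  define d where "d = \<lfloor>x\<rfloor> + \<lfloor>y\<rfloor> - z"
  have "\<bar>frac x + frac y + of_int d\<bar> \<le> \<epsilon>" using * by (simp add: frac_def d_def)
  moreover have "d \<ge> 0 \<or> d = - 1 \<or> d \<le> - 2" by linarith
  then have "real_of_int d \<ge> 0 \<or> real_of_int d = - 1 \<or> real_of_int d \<le> - 2" by linarith
  ultimately show False using assms by (auto simp: abs_le_iff)
qed


text \<open>
  By \<open>hyperbola_chord\<close> below, \<open>p dvd b * u * v + a\<close> is the condition for the points of the hyperbola with
  abscissae \<open>u\<close> and \<open>v\<close> to lie on a common line of direction \<open>(a, b)\<close>.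
\<close>

definition separates_chords :: "int \<Rightarrow> int \<Rightarrow> int set \<Rightarrow> int set \<Rightarrow> bool" where
  "separates_chords r p C D \<longleftrightarrow>
    C \<subseteq> {0<..<p} \<and> D \<subseteq> {0<..<p} \<and> C \<inter> D = {} \<and>
    (\<forall>u v a b. u \<in> C \<and> v \<in> C \<or> u \<in> D \<and> v \<in> D \<longrightarrow> 0 < a \<longrightarrow> a \<le> r \<longrightarrow>
      b \<noteq> 0 \<longrightarrow> \<bar>b\<bar> \<le> r \<longrightarrow> \<not> p dvd b * u * v + a)"

lemma separates_chords_commute: "separates_chords r p C D \<longleftrightarrow> separates_chords r p D C"
  unfolding separates_chords_def by (simp only: disj_commute conj_ac Int_commute)

lemma separates_chordsD:
  "separates_chords r p C D \<Longrightarrow> u \<in> C \<and> v \<in> C \<or> u \<in> D \<and> v \<in> D \<Longrightarrow>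
    0 < a \<Longrightarrow> a \<le> r \<Longrightarrow> b \<noteq> 0 \<Longrightarrow> \<bar>b\<bar> \<le> r \<Longrightarrow> \<not> p dvd b * u * v + a"
  unfolding separates_chords_def by (elim conjE allE impE) assumption+

text \<open>To base \<open>g\<close>, a chord satisfies
  \<open>log u + log v = log a - log |b|\<close> modulo \<open>p - 1\<close>, with
  \<open>log (-1)\<close> added if \<open>b > 0\<close>. After multiplication by
  \<open>q / N\<close> the right side is within \<open>3 / Q < 2 * \<delta>\<close> of an integer,
  which equal colours forbid.\<close>

lemma eventually_separates_chords:
  fixes r :: nat and \<eta> :: real
  assumes "0 < \<eta>"
  shows "\<forall>\<^sub>F p in sequentially. prime p \<longrightarrow>
    (\<exists>C D. separates_chords (int r) (int p) C D \<and> (1 - \<eta>) * real p \<le> real (card C + card D))"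
proof -
  \<comment> \<open>The 9 gives \<open>\<delta> < 1/2\<close>. The other entry gives
    \<open>6 * \<delta> \<le> \<eta> / 2\<close> for the proportion of uncoloured residues; the
    other half of \<open>\<eta> * p\<close> pays for the terms bounded in \<open>p\<close>.\<close>
  define Q where "Q = max 9 (nat \<lceil>24 / \<eta>\<rceil>)"
  define \<delta> where "\<delta> = 2 / real Q"
  have Q: "9 \<le> Q" "24 / \<eta> \<le> real Q" 
    using real_nat_ceiling_ge[of "24 / \<eta>"] by (auto simp: Q_def)
  have \<delta>: "0 \<le> \<delta>" "\<delta> < 1/2" "12 * \<delta> \<le> \<eta>"
    using Q assms by (auto simp: \<delta>_def field_simps)
  have "\<forall>\<^sub>F p in sequentially. 2 * real (Q ^ (r + 1)) + 2 \<le> \<eta> / 2 * real p"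
    using assms by real_asymp
  then show ?thesis
    using eventually_gt_at_top[of r] eventually_gt_at_top[of 2]
  proof (eventually_elim, intro impI)
    case (elim p)
    assume p: "prime p"
    define N where "N = p - 1"
    have N: "0 < N" "real N = real p - 1" using elim by (auto simp: N_def of_nat_diff)
    obtain g where g: "residue_primroot p g" using prime_primitive_root_exists[OF _ p] elim by auto
    have cop: "coprime p g" and ord: "ord p g = N"
      using g p by (auto simp: residue_primroot_def totient_prime N_def)
    have bij: "bij_betw (\<lambda>i. g ^ i mod p) {..<N} {0<..<p}"
      using residue_primroot_is_generator[OF _ g] elim p
      by (simp add: totient_prime totatives_prime N_def)
    have "\<exists>i. [g ^ i = a] (mod p)" if "a \<in> {0<..<p}" for a
    proof -
      have "a \<in> (\<lambda>i. g ^ i mod p) ` {..<N}" using bij that by (simp add: bij_betw_def)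
      then show ?thesis by (auto simp: cong_def)
    qed
    then obtain e where e: "\<And>a. a \<in> {0<..<p} \<Longrightarrow> [g ^ e a = a] (mod p)" by metis
    \<comment> \<open>Index 0 stands for the residue -1 and index \<open>i\<close> from 1 to
      \<open>r\<close> for \<open>i\<close> itself. Dirichlet's bound \<open>Q ^ (r + 1)\<close> on
      \<open>q\<close> does not depend on \<open>p\<close>.\<close>
    define \<theta> where "\<theta> i = real (e (if i = 0 then p - 1 else i)) / real N" for i
    obtain q P where q: "0 < q" "q \<le> int (Q ^ (r + 1))"
      and P: "\<And>i. i < r + 1 \<Longrightarrow> \<bar>of_int q * \<theta> i - of_int (P i)\<bar> < 1 / real Q"
      using Dirichlet_approx_simult[of Q "r + 1" \<theta>] Q by auto
    define \<phi> where "\<phi> i = of_int q * real i / real N" for i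
    define c where "c i \<longleftrightarrow> \<delta> < frac (\<phi> i) \<and> frac (\<phi> i) < 1/2 - \<delta>" for i
    define d where "d i \<longleftrightarrow> 1/2 + \<delta> < frac (\<phi> i) \<and> frac (\<phi> i) < 1 - \<delta>" for i
    define C where "C = (\<lambda>i. g ^ i mod p) ` {i. i < N \<and> c i}"
    define D where "D = (\<lambda>i. g ^ i mod p) ` {i. i < N \<and> d i}"
    have inj: "inj_on (\<lambda>i. g ^ i mod p) {..<N}" using bij by (simp add: bij_betw_def)
    have sub: "C \<subseteq> {0<..<p}" "D \<subseteq> {0<..<p}"
      using bij_betw_imp_surj_on[OF bij] unfolding C_def D_def by blast+
    have "{i. i < N \<and> c i} \<inter> {i. i < N \<and> d i} = {}"
      using \<delta> by (auto simp: c_def d_def)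
    then have disj: "C \<inter> D = {}"
      unfolding C_def D_def by (subst inj_on_image_Int[OF inj, symmetric]) auto
    have count: "(1 - \<eta>) * real p \<le> real (card C + card D)"
    proof -
      define S where "S = {i. i < N \<and> (\<exists>j::int. \<bar>2 * of_int q * real i / real N - of_int j\<bar> \<le> 2 * \<delta>)}"
      have "{..<N} \<subseteq> {i. i < N \<and> c i} \<union> {i. i < N \<and> d i} \<union> S"
      proof
        fix i assume "i \<in> {..<N}"
        then show "i \<in> {i. i < N \<and> c i} \<union> {i. i < N \<and> d i} \<union> S"
          using not_half_colored_imp_near[of \<delta> "\<phi> i"]
          by (auto simp: c_def d_def S_def \<phi>_def mult.assoc)
      qed
      then have "card {..<N} \<le> card ({i. i < N \<and> c i} \<union> {i. i < N \<and> d i} \<union> S)"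
        by (intro card_mono) (auto simp: S_def)
      also have "\<dots> \<le> card {i. i < N \<and> c i} + card {i. i < N \<and> d i} + card S"
        by (intro order_trans[OF card_Un_le] add_mono card_Un_le) auto
      also have "card {i. i < N \<and> c i} = card C"
        unfolding C_def by (intro card_image[symmetric] inj_on_subset[OF inj]) auto
      also have "card {i. i < N \<and> d i} = card D"
        unfolding D_def by (intro card_image[symmetric] inj_on_subset[OF inj]) auto
      finally have "real N \<le> real (card C + card D) + real (card S)" by simp
      also have "real (card S) \<le> 6 * \<delta> * real N + 2 * of_int q + 1"
        unfolding S_def using card_near_half_integers_le[OF q(1) N(1) \<delta>(1,2)] .
      also have "real_of_int q \<le> real (Q ^ (r + 1))"
        using q(2) by (metis of_int_le_iff of_int_of_nat_eq)
      also have "6 * \<delta> * real N \<le> \<eta> / 2 * real p"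
        using \<delta> N by (intro mult_mono) auto
      finally show ?thesis using elim(1) N(2) by (simp add: algebra_simps)
    qed
    have nearI: "\<exists>w::int. \<bar>\<phi> x + \<phi> y - of_int w\<bar> \<le> 3 / real Q"
      if "u = g ^ x mod p" "v = g ^ y mod p" "0 < a" "a \<le> int r" "b \<noteq> 0" "\<bar>b\<bar> \<le> int r"
        "int p dvd b * int u * int v + a" for u v x y a b
    proof -
      define A where "A = nat a"
      define B where "B = nat \<bar>b\<bar>"
      have AB: "A \<in> {0<..<p}" "B \<in> {0<..<p}" "A < r + 1" "B < r + 1" "A \<noteq> 0" "B \<noteq> 0"
        using that elim by (auto simp: A_def B_def)
      have uv: "[g ^ x = u] (mod p)" "[g ^ y = v] (mod p)" using that by (auto simp: cong_def)
      have Buv: "[g ^ (e B + x + y) = B * u * v] (mod p)"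
        unfolding power_add using e[OF AB(2)] uv by (intro cong_mult)
      \<comment> \<open>Exponents are known only modulo \<open>N\<close>, but the factor
        \<open>q / N\<close> turns an ambiguity \<open>N * z\<close> into the integer
        \<open>q * z\<close>.\<close>
      have dist: "\<phi> x + \<phi> y = of_int q * (real E / real N) - of_int q * \<theta> B + of_int (q * z)"
        if "int (e B + x + y) = int E + int N * z" for E z
      proof -
        have "real_of_int (int (e B + x + y)) = of_int (int E + int N * z)" using that by simp
        then have "real x + real y = real E - real (e B) + real N * of_int z" by simp
        then have "\<phi> x + \<phi> y = of_int q * (real E - real (e B) + real N * of_int z) / real N"
          unfolding \<phi>_def by (simp add: add_divide_distrib[symmetric] distrib_left[symmetric])
        then show ?thesis using N(1) AB(6) by (simp add: \<theta>_def field_simps)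
      qed
      have exp: "\<exists>z. int (e B + x + y) = int E + int N * z" if "[B * u * v = g ^ E] (mod p)" for E
      proof -
        have "[g ^ (e B + x + y) = g ^ E] (mod p)" using Buv that by (rule cong_trans)
        then have "[e B + x + y = E] (mod N)" by (simp add: order_divides_expdiff[OF cop] ord)
        then have "[int E = int (e B + x + y)] (mod int N)" by (simp only: cong_int_iff cong_sym_eq)
        then show ?thesis by (metis cong_iff_lin)
      qed
      show ?thesis
      proof (cases "0 < b")
        case True
        then have "int p dvd int (B * u * v + A)" using that by (simp add: A_def B_def)
        then have "[B * u * v + A = 0] (mod p)" by (simp only: int_dvd_int_iff cong_0_iff)
        \<comment> \<open>In the naturals, \<open>-A\<close> is represented by
          \<open>(p - 1) * A\<close>; this is where the logarithm of -1 enters.\<close>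
        moreover have "(p - 1) * A + A = p * A" using elim by (cases p) auto
        then have "[(p - 1) * A + A = 0] (mod p)" by (simp add: cong_0_iff)
        ultimately have "[B * u * v + A = (p - 1) * A + A] (mod p)" by (metis cong_trans cong_sym)
        then have "[B * u * v = (p - 1) * A] (mod p)" by (simp only: cong_add_rcancel_nat)
        moreover have "[g ^ (e (p - 1) + e A) = (p - 1) * A] (mod p)"
          unfolding power_add using e[OF AB(1)] e[of "p - 1"] elim by (intro cong_mult) auto
        ultimately have "[B * u * v = g ^ (e (p - 1) + e A)] (mod p)" by (metis cong_trans cong_sym)
        from exp[OF this] obtain z where "int (e B + x + y) = int (e (p - 1) + e A) + int N * z" ..
        from dist[OF this]
        have "\<phi> x + \<phi> y = of_int q * \<theta> 0 + of_int q * \<theta> A - of_int q * \<theta> B + of_int (q * z)"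
          using AB(5) by (simp add: \<theta>_def add_divide_distrib distrib_left)
        then show ?thesis using P[of 0] P[OF AB(3)] P[OF AB(4)]
          by (intro exI[of _ "P 0 + P A - P B + q * z"]) (simp add: abs_le_iff abs_less_iff)
      next
        case False
        then have "int p dvd int A - int (B * u * v)"
          using that by (simp add: A_def B_def add.commute)
        then have "[int A = int (B * u * v)] (mod int p)" by (simp only: cong_iff_dvd_diff)
        then have "[B * u * v = A] (mod p)" by (simp only: cong_int_iff cong_sym_eq)
        then have "[B * u * v = g ^ e A] (mod p)" using e[OF AB(1)] by (metis cong_trans cong_sym)
        from exp[OF this] obtain z where "int (e B + x + y) = int (e A) + int N * z" ..
        from dist[OF this]
        have "\<phi> x + \<phi> y = of_int q * \<theta> A - of_int q * \<theta> B + of_int (q * z)"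
          using AB(5) by (simp add: \<theta>_def)
        then show ?thesis using P[OF AB(3)] P[OF AB(4)]
          by (intro exI[of _ "P A - P B + q * z"]) (simp add: abs_le_iff abs_less_iff)
      qed
    qed
    have "3 / real Q \<le> 2 * \<delta>" by (simp add: \<delta>_def divide_right_mono)
    then have "\<not> int p dvd b * int u * int v + a"
      if uv: "u \<in> C \<and> v \<in> C \<or> u \<in> D \<and> v \<in> D" and ab: "0 < a" "a \<le> int r" "b \<noteq> 0" "\<bar>b\<bar> \<le> int r"
      for u v a b
    proof -
      obtain x y where xy: "u = g ^ x mod p" "v = g ^ y mod p" "c x \<and> c y \<or> d x \<and> d y"
        using uv unfolding C_def D_def by auto
      then show ?thesis
        using half_colored_add_not_near[of \<delta> "\<phi> x" "\<phi> y" "3 / real Q"] nearI[OF xy(1,2) ab]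
          \<open>3 / real Q \<le> 2 * \<delta>\<close> unfolding c_def d_def by blast
    qed
    then have "separates_chords (int r) (int p) (int ` C) (int ` D)"
      using sub disj unfolding separates_chords_def by (auto simp: image_iff)
    moreover have "card (int ` C) = card C" "card (int ` D) = card D"
      by (simp_all add: card_image)
    ultimately show "\<exists>C D. separates_chords (int r) (int p) C D \<and>
        (1 - \<eta>) * real p \<le> real (card C + card D)"
      using count by metis
  qed
qed

section \<open>Lifting the hyperbola to the grid\<close>

text \<open>The offset \<open>e\<close> is constant along the direction \<open>(a, b)\<close> and
  thus labels the parallel lines of that direction.\<close>

definition cells_on_line :: "(int \<times> int) set \<Rightarrow> int \<Rightarrow> int \<Rightarrow> int \<Rightarrow> (int \<times> int) set" where
  "cells_on_line S a b e = {(i, j) \<in> S. a * j - b * i = e}"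

definition real_point :: "int \<times> int \<Rightarrow> real \<times> real" where
  "real_point z = (real_of_int (fst z), real_of_int (snd z))"

lemma inj_real_point: "inj real_point"
  by (auto simp: inj_on_def real_point_def prod_eq_iff)

section \<open>From real lines to primitive integer directions\<close>

lemma collinear_of_is_line:
  assumes "is_line L" "P \<in> L" "Q \<in> L" "P \<noteq> Q" "Z \<in> L"
  shows "(fst Q - fst P) * (snd Z - snd P) = (snd Q - snd P) * (fst Z - fst P)"
proof -
  have L: "affine L" "aff_dim L = 1" using assms(1) by (auto simp: is_line_def)
  have "affine hull {P, Q} = L"
  proof (rule affine_dim_equal)
    show "affine hull {P, Q} \<subseteq> L" using L assms by (intro hull_minimal) auto
  qed (use L assms in \<open>auto simp: aff_dim_affine_hull\<close>)
  then obtain u where "Z = P + u *\<^sub>R (Q - P)" using assms(5) unfolding affine_hull_2_alt by auto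
  then have "fst Z - fst P = u * (fst Q - fst P)" "snd Z - snd P = u * (snd Q - snd P)" by simp_all
  then show ?thesis by simp
qed

text \<open>Only lines through two points of the set matter. Their difference divided by its gcd is
  a primitive direction, and a sign change brings it to the required form; for \<open>a = 0\<close>
  coprimality then forces \<open>b = 1\<close>.\<close>

lemma at_most_per_line_realI:
  assumes "finite S"
    and "\<And>a b c. coprime a b \<Longrightarrow> 0 < a \<or> a = 0 \<and> b = 1 \<Longrightarrow> card (cells_on_line S a b c) \<le> k"
    and "0 < k"
  shows "at_most_per_line k (real_point ` S)"
  unfolding at_most_per_line_def
proof (intro allI impI)
  fix L assume L: "is_line L"
  define T where "T = {z \<in> S. real_point z \<in> L}"
  have fin: "finite T" using assms(1) by (simp add: T_def)
  have "real_point ` S \<inter> L = real_point ` T" by (auto simp: T_def)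
  then have card: "card (real_point ` S \<inter> L) = card T"
    by (simp add: card_image inj_on_subset[OF inj_real_point])
  show "card (real_point ` S \<inter> L) \<le> k"
  proof (cases "card T \<le> 1")
    case True
    then show ?thesis using card assms(3) by linarith
  next
    case False
    then obtain P Q where PQ: "P \<in> T" "Q \<in> T" "P \<noteq> Q"
      by (metis card_le_Suc0_iff_eq fin One_nat_def)
    define g where "g = gcd (fst Q - fst P) (snd Q - snd P)"
    have "fst Q - fst P \<noteq> 0 \<or> snd Q - snd P \<noteq> 0" using PQ by (auto simp: prod_eq_iff)
    then obtain a' b' where ab': "fst Q - fst P = a' * g" "snd Q - snd P = b' * g" "coprime a' b'" "g \<noteq> 0"
      unfolding g_def using gcd_coprime_exists[of "fst Q - fst P" "snd Q - snd P"] by auto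
    define s :: int where "s = (if 0 < a' \<or> a' = 0 \<and> 0 < b' then 1 else - 1)"
    define a where "a = s * a'"
    define b where "b = s * b'"
    have ab: "coprime a b" "0 < a \<or> a = 0 \<and> b = 1"
      using ab'(3) by (auto simp: a_def b_def s_def)
    have "T \<subseteq> cells_on_line S a b (a * snd P - b * fst P)"
    proof
      fix Z assume Z: "Z \<in> T"
      have "(fst (real_point Q) - fst (real_point P)) * (snd (real_point Z) - snd (real_point P))
          = (snd (real_point Q) - snd (real_point P)) * (fst (real_point Z) - fst (real_point P))"
        using PQ Z inj_real_point
        by (intro collinear_of_is_line[OF L]) (auto simp: T_def dest: injD)
      then have "real_of_int ((fst Q - fst P) * (snd Z - snd P)) = of_int ((snd Q - snd P) * (fst Z - fst P))"
        by (simp add: real_point_def)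
      then have "(fst Q - fst P) * (snd Z - snd P) = (snd Q - snd P) * (fst Z - fst P)"
        by (simp only: of_int_eq_iff)
      then have "g * (a' * (snd Z - snd P)) = g * (b' * (fst Z - fst P))"
        unfolding ab' by (simp add: ac_simps)
      then have "a' * (snd Z - snd P) = b' * (fst Z - fst P)" using ab'(4) by simp
      then have "a * snd Z - b * fst Z = a * snd P - b * fst P"
        by (auto simp: a_def b_def s_def algebra_simps)
      then show "Z \<in> cells_on_line S a b (a * snd P - b * fst P)"
        using Z by (auto simp: cells_on_line_def T_def)
    qed
    moreover have "finite (cells_on_line S a b (a * snd P - b * fst P))"
      using assms(1) by (auto simp: cells_on_line_def intro: finite_subset)
    ultimately have "card T \<le> card (cells_on_line S a b (a * snd P - b * fst P))"
      by (intro card_mono)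
    then show ?thesis using assms(2)[OF ab] card by (metis order_trans)
  qed
qed

lemma le_max_ptsI:
  assumes "S \<subseteq> {1..int n} \<times> {1..int n}"
    and "\<And>a b c. coprime a b \<Longrightarrow> 0 < a \<or> a = 0 \<and> b = 1 \<Longrightarrow> card (cells_on_line S a b c) \<le> k"
    and "0 < k"
  shows "card S \<le> max_pts k n"
proof -
  have fin: "finite S" using assms(1) finite_subset by blast
  have "real_point ` S \<subseteq> grid n"
  proof
    fix z assume "z \<in> real_point ` S"
    then obtain x y where xy: "z = (real_of_int x, real_of_int y)" "x \<in> {1..int n}" "y \<in> {1..int n}"
      using assms(1) by (auto simp: real_point_def)
    then have "z = (\<lambda>(i, j). (real i, real j)) (nat x, nat y)" "(nat x, nat y) \<in> {1..n} \<times> {1..n}"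
      by auto
    then show "z \<in> grid n" unfolding grid_def by blast
  qed
  then have "card (real_point ` S) \<in> {card S | S. S \<subseteq> grid n \<and> at_most_per_line k S}"
    using at_most_per_line_realI[OF fin assms(2,3)] by blast
  then have "card (real_point ` S) \<le> max_pts k n"
    unfolding max_pts_def using max_pts_set_finite by (rule Max_ge[rotated])
  then show ?thesis by (simp add: card_image inj_on_subset[OF inj_real_point])
qed


text \<open>
  Cells of \<open>A\<close> and \<open>B\<close> on pattern lines with offsets \<open>e\<close> and \<open>f\<close> can end up on the same line of the grid
  only if \<open>\<bar>e - f\<bar> \<le> a + \<bar>b\<bar> - 2\<close>; see \<open>hyperbola_chord_window\<close>.
\<close>

definition compatible_patterns :: "int \<Rightarrow> (int \<times> int) set \<Rightarrow> (int \<times> int) set \<Rightarrow> bool" where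
  "compatible_patterns t A B \<longleftrightarrow>
    A \<subseteq> {0..<t} \<times> {0..<t} \<and> B \<subseteq> {0..<t} \<times> {0..<t} \<and>
    (\<forall>S\<in>{A, B}. \<forall>e. card (cells_on_line S 1 0 e) \<le> 3 \<and> card (cells_on_line S 0 1 e) \<le> 3) \<and>
    (\<forall>a b e f. coprime a b \<longrightarrow> 0 < a \<longrightarrow> a < t \<longrightarrow> b \<noteq> 0 \<longrightarrow> \<bar>b\<bar> < t \<longrightarrow> \<bar>e - f\<bar> \<le> a + \<bar>b\<bar> - 2 \<longrightarrow>
      card (cells_on_line A a b e) + card (cells_on_line B a b f) \<le> 3)"

text \<open>Cells on one line differ by a multiple of \<open>(a, b)\<close>, and a nonzero multiple
  would leave the box.\<close>

lemma card_cells_on_line_le_1: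
  assumes "coprime a b" "S \<subseteq> {0..<t} \<times> {0..<t}" "t \<le> \<bar>a\<bar> \<or> t \<le> \<bar>b\<bar>"
  shows "card (cells_on_line S a b e) \<le> 1"
proof -
  have "finite S" using assms(2) finite_subset by blast
  then have fin: "finite (cells_on_line S a b e)"
    by (auto simp: cells_on_line_def intro: finite_subset)
  have "z = z'" if z: "z \<in> cells_on_line S a b e" "z' \<in> cells_on_line S a b e" for z z'
  proof -
    obtain i j i' j' where ij: "z = (i, j)" "z' = (i', j')" by (cases z, cases z')
    have eq: "a * (j - j') = b * (i - i')"
      using z by (auto simp: ij cells_on_line_def algebra_simps)
    have "z \<in> {0..<t} \<times> {0..<t}" "z' \<in> {0..<t} \<times> {0..<t}"
      using z assms(2) by (auto simp only: cells_on_line_def)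
    then have bd: "\<bar>i - i'\<bar> < t" "\<bar>j - j'\<bar> < t" by (auto simp: ij)
    have "a dvd i - i'" using eq assms(1) by (metis coprime_dvd_mult_right_iff dvd_triv_left)
    moreover have "b dvd j - j'" using eq assms(1)
      by (metis coprime_commute coprime_dvd_mult_right_iff dvd_triv_left)
    ultimately have "t \<le> \<bar>a\<bar> \<Longrightarrow> i = i'" "t \<le> \<bar>b\<bar> \<Longrightarrow> j = j'"
      using bd dvd_imp_le_int[of "i - i'" a] dvd_imp_le_int[of "j - j'" b] by auto
    moreover have "t \<le> \<bar>a\<bar> \<Longrightarrow> a \<noteq> 0" "t \<le> \<bar>b\<bar> \<Longrightarrow> b \<noteq> 0" using bd by auto
    ultimately show ?thesis using eq assms(3) by (auto simp: ij)
  qed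
  then show ?thesis using fin by (metis One_nat_def card_le_Suc0_iff_eq)
qed

text \<open>Modulo \<open>p\<close>, substituting \<open>w = 1/u\<close> and \<open>x = 1/v\<close>
  turns equality of offsets into \<open>(u - v) * (b * u * v + a) = 0\<close>, and
  \<open>u - v\<close> is invertible.\<close>

lemma hyperbola_chord:
  fixes p :: int
  assumes "prime p" "u \<in> {0<..<p}" "v \<in> {0<..<p}" "u \<noteq> v"
    and "p dvd u * w - 1" "p dvd v * x - 1" "p dvd (a * w - b * u) - (a * x - b * v)"
  shows "p dvd b * u * v + a"
proof -
  have "(u - v) * (b * u * v + a) = a * v * (u * w - 1) - a * u * (v * x - 1)
      - u * v * ((a * w - b * u) - (a * x - b * v))"
    by (simp add: algebra_simps)
  also have "p dvd \<dots>"
    using assms(5-7) by (meson dvd_diff dvd_mult)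
  finally have "p dvd (u - v) * (b * u * v + a)" .
  moreover have "\<not> p dvd u - v"
    using assms(2-4) dvd_imp_le_int[of "u - v" p] by auto
  ultimately show ?thesis using assms(1) by (simp add: prime_dvd_mult_iff)
qed

text \<open>Size alone gives only \<open>a + |b| - 1\<close>. The chord relation makes
  \<open>a * w + b * v = p * k\<close> and \<open>a * x + b * u = p * l\<close>, with
  \<open>f - e = k - l\<close>. Both \<open>k\<close> and \<open>l\<close> lie strictly between two
  integers at distance \<open>a + |b|\<close>, which saves one.\<close>

lemma hyperbola_chord_window:
  fixes p :: int
  assumes "0 < a" "b \<noteq> 0" "p dvd b * u * v + a"
    and "u \<in> {0<..<p}" "v \<in> {0<..<p}" "w \<in> {0<..<p}" "x \<in> {0<..<p}"
    and "p dvd u * w - 1" "p dvd v * x - 1"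
    and "a * w - b * u + p * e = a * x - b * v + p * f"
  shows "\<bar>e - f\<bar> \<le> a + \<bar>b\<bar> - 2"
proof -
  have p: "0 < p" using assms(4) by auto
  have "a * w + b * v = w * (b * u * v + a) - b * v * (u * w - 1)" by (simp add: algebra_simps)
  also have "p dvd \<dots>" using assms(3,8) by (meson dvd_diff dvd_mult)
  finally obtain k where k: "a * w + b * v = p * k" by (elim dvdE)
  have "a * x + b * u = x * (b * u * v + a) - b * u * (v * x - 1)" by (simp add: algebra_simps)
  also have "p dvd \<dots>" using assms(3,9) by (meson dvd_diff dvd_mult)
  finally obtain l where l: "a * x + b * u = p * l" by (elim dvdE)
  have "p * (f - e) = p * (k - l)" using k l assms(10) by (simp add: algebra_simps)
  then have fe: "f - e = k - l" using p by simp
  have aw: "0 < a * w" "a * w < p * a" "0 < a * x" "a * x < p * a"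
    using assms by (auto simp: mult.commute)
  show ?thesis
  proof (cases "0 < b")
    case True
    then have "0 < b * v" "b * v < p * b" "0 < b * u" "b * u < p * b"
      using assms by (auto simp: mult.commute)
    then have "p * 0 < p * k" "p * k < p * (a + b)" "p * 0 < p * l" "p * l < p * (a + b)"
      using aw unfolding k[symmetric] l[symmetric] by (simp_all add: distrib_left)
    then have "0 < k" "k < a + b" "0 < l" "l < a + b" using p by (simp_all add: zero_less_mult_iff)
    then show ?thesis using fe True by linarith
  next
    case False
    then have b: "b < 0" using assms(2) by simp
    then have "b * v < 0" "p * b < b * v" "b * u < 0" "p * b < b * u"
      using assms by (auto simp: mult.commute mult_neg_pos)
    then have "p * b < p * k" "p * k < p * a" "p * b < p * l" "p * l < p * a"
      using aw unfolding k[symmetric] l[symmetric] by simp_all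
    then have "b < k" "k < a" "b < l" "l < a" using p by simp_all
    then show ?thesis using fe b by linarith
  qed
qed


text \<open>With \<open>w\<close> an inverse modulo \<open>p\<close>, \<open>(u, w u)\<close> is a
  point of the hyperbola, and cell \<open>(i, j)\<close> stands for the block with corner
  \<open>(i * p, j * p)\<close>.\<close>

definition hyperbola_lift ::
  "int \<Rightarrow> (int \<Rightarrow> int) \<Rightarrow> int set \<Rightarrow> (int \<times> int) set \<Rightarrow> (int \<times> int) set" where
  "hyperbola_lift p w C S = (\<lambda>(u, i, j). (u + i * p, w u + j * p)) ` (C \<times> S)"

text \<open>Points on the line are grouped by the abscissa \<open>u\<close> of their hyperbola
  point. At most two abscissae occur. A single one carries at most three points by its own pattern;
  two have different colours and offsets within the window, so compatibility bounds their
  total.\<close>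

lemma card_hyperbola_lifts_on_line:
  fixes p t :: int
  assumes p: "prime p" and sep: "separates_chords t p C D"
    and w: "\<And>u. u \<in> {0<..<p} \<Longrightarrow> w u \<in> {0<..<p} \<and> p dvd u * w u - 1"
    and compat: "compatible_patterns t A B"
    and ab: "coprime a b" "0 < a \<or> a = 0 \<and> b = 1"
  shows "card (cells_on_line (hyperbola_lift p w C A \<union> hyperbola_lift p w D B) a b c) \<le> 3"
proof -
  have CD: "C \<subseteq> {0<..<p}" "D \<subseteq> {0<..<p}" "C \<inter> D = {}"
    using sep by (auto simp only: separates_chords_def)
  define S where "S u = (if u \<in> C then A else B)" for u
  define K where "K u = {(i, j) \<in> S u. a * (w u + j * p) - b * (u + i * p) = c}" for u
  define U where "U = {u \<in> C \<union> D. K u \<noteq> {}}"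
  have p1: "1 < p" using p by (simp add: prime_gt_1_int)
  have AB: "A \<subseteq> {0..<t} \<times> {0..<t}" "B \<subseteq> {0..<t} \<times> {0..<t}"
    using compat by (auto simp only: compatible_patterns_def)
  have S: "S u \<subseteq> {0..<t} \<times> {0..<t}" for u using AB by (simp add: S_def)
  have finS: "finite (S u)" for u using S finite_subset by blast
  have finK: "finite (K u)" for u
    using finS[of u] by (auto simp: K_def intro: finite_subset)
  have U: "U \<subseteq> {0<..<p}" using CD by (auto simp: U_def)
  then have finU: "finite U" using finite_subset by blast
  have K_line: "K u \<subseteq> cells_on_line (S u) a b e" if "a * w u - b * u + p * e = c" for u e
  proof
    fix z assume "z \<in> K u"
    then obtain i j where ij: "z = (i, j)" "(i, j) \<in> S u" "a * (w u + j * p) - b * (u + i * p) = c"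
      by (auto simp: K_def)
    then have "p * (a * j - b * i) = p * e" using that by (simp add: algebra_simps)
    then show "z \<in> cells_on_line (S u) a b e" using p1 ij by (simp add: cells_on_line_def)
  qed
  have ex_e: "\<exists>e. a * w u - b * u + p * e = c" if "u \<in> U" for u
  proof -
    have "K u \<noteq> {}" using that by (simp add: U_def)
    then obtain z where "z \<in> K u" by blast
    then obtain i j where "a * (w u + j * p) - b * (u + i * p) = c" by (auto simp: K_def)
    then show ?thesis by (intro exI[of _ "a * j - b * i"]) (simp add: algebra_simps)
  qed
  have finL: "finite (cells_on_line (S u) a b e)" for u e
    using finS[of u] by (auto simp: cells_on_line_def intro: finite_subset)
  have card_K: "card (K u) \<le> card (cells_on_line (S u) a b e)" if "a * w u - b * u + p * e = c" for u e
    using K_line[OF that] finL by (intro card_mono)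
  have wide: "card (K u) \<le> 1" if u: "u \<in> U" "t \<le> \<bar>a\<bar> \<or> t \<le> \<bar>b\<bar>" for u
  proof -
    obtain e where "a * w u - b * u + p * e = c" using ex_e[OF u(1)] ..
    then show ?thesis
      using card_K[of u e] card_cells_on_line_le_1[OF ab(1) S u(2), of u e] by linarith
  qed
  have chord: "p dvd b * u * v + a" if uv: "u \<in> U" "v \<in> U" "u \<noteq> v" for u v
  proof (rule hyperbola_chord[OF p])
    obtain e f where "a * w u - b * u + p * e = c" "a * w v - b * v + p * f = c"
      using ex_e[OF uv(1)] ex_e[OF uv(2)] by blast
    then have "(a * w u - b * u) - (a * w v - b * v) = p * (f - e)" by (simp add: algebra_simps)
    then show "p dvd (a * w u - b * u) - (a * w v - b * v)" by simp
  qed (use uv U w in auto)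
  have nondvd: "\<not> p dvd u" if "u \<in> U" for u
    using that U zdvd_not_zless by fastforce
  \<comment> \<open>The chord relation gives \<open>p dvd a\<close> iff \<open>p dvd b\<close>, and
    coprimality excludes both. In particular a line with two abscissae is not parallel to an
    axis.\<close>
  have b0: "\<not> p dvd b" and a0: "\<not> p dvd a" if "u \<in> U" "v \<in> U" "u \<noteq> v" for u v
  proof -
    have "p dvd a \<longleftrightarrow> p dvd b"
      using chord[OF that] nondvd[OF that(1)] nondvd[OF that(2)] p
      by (metis dvd_add_right_iff dvd_mult dvd_mult2 dvd_add_left_iff prime_dvd_mult_iff)
    moreover have "\<not> (p dvd a \<and> p dvd b)" 
      using coprime_common_divisor[OF ab(1), of p] p1 by (auto simp: zdvd1_eq)
    ultimately show "\<not> p dvd b" "\<not> p dvd a" by auto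
  qed
  have three: "card (K u) \<le> 3" if u: "u \<in> U" for u
  proof (cases "t \<le> \<bar>a\<bar> \<or> t \<le> \<bar>b\<bar>")
    case True
    then show ?thesis using wide[OF u] by simp
  next
    case False
    obtain e where e: "a * w u - b * u + p * e = c" using ex_e[OF u] ..
    have "card (cells_on_line (S u) a b e) \<le> 3"
    proof (cases "0 < a \<and> b \<noteq> 0")
      case True
      \<comment> \<open>Equal offsets are admissible because \<open>a + |b| \<ge> 2\<close>.\<close>
      then have "card (cells_on_line A a b e) + card (cells_on_line B a b e) \<le> 3"
        using compat ab False unfolding compatible_patterns_def by auto
      then show ?thesis by (simp add: S_def)
    next
      case False
      then have "a = 1 \<and> b = 0 \<or> a = 0 \<and> b = 1" using ab by auto
      then show ?thesis using compat unfolding compatible_patterns_def by (auto simp: S_def)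
    qed
    then show ?thesis using card_K[OF e] by linarith
  qed
  have pair: "card (K u) + card (K v) \<le> 3" if uv: "u \<in> U" "v \<in> U" "u \<noteq> v" for u v
  proof (cases "t \<le> \<bar>a\<bar> \<or> t \<le> \<bar>b\<bar>")
    case True
    then show ?thesis using wide[OF uv(1)] wide[OF uv(2)] by linarith
  next
    case False
    have ab0: "0 < a" "b \<noteq> 0" using a0[OF uv] b0[OF uv] ab by auto
    have main: "card (K u) + card (K v) \<le> 3"
      if uv: "u \<in> C" "v \<in> D" "u \<in> U" "v \<in> U" "u \<noteq> v" for u v
    proof -
      obtain e f where ef: "a * w u - b * u + p * e = c" "a * w v - b * v + p * f = c"
        using ex_e[OF uv(3)] ex_e[OF uv(4)] by blast
      have "\<bar>e - f\<bar> \<le> a + \<bar>b\<bar> - 2"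
        using uv U w ef by (intro hyperbola_chord_window[where w = "w u" and x = "w v", OF ab0 chord]) auto
      then have "card (cells_on_line A a b e) + card (cells_on_line B a b f) \<le> 3"
        using compat ab(1) ab0 False unfolding compatible_patterns_def by auto
      moreover have "v \<notin> C" using uv CD by auto
      ultimately show ?thesis using card_K[OF ef(1)] card_K[OF ef(2)] uv by (simp add: S_def)
    qed
    have "\<not> (u \<in> C \<and> v \<in> C \<or> u \<in> D \<and> v \<in> D)"
      using separates_chordsD[OF sep, of u v a b] chord[OF uv] ab0 False by auto
    moreover have "u \<in> C \<union> D" "v \<in> C \<union> D" using uv by (auto simp: U_def)
    ultimately have "u \<in> C \<and> v \<in> D \<or> v \<in> C \<and> u \<in> D" by auto
    then show ?thesis using main uv by (metis add.commute)
  qed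
  \<comment> \<open>Both \<open>v\<close> and \<open>x\<close> are congruent to
    \<open>-a / (b * u)\<close>, so \<open>u\<close> determines its partner.\<close>
  have two: "v = x" if "u \<in> U" "v \<in> U" "x \<in> U" "u \<noteq> v" "u \<noteq> x" for u v x
  proof (rule ccontr)
    assume "v \<noteq> x"
    have "p dvd (b * u * v + a) - (b * u * x + a)" using chord that by (intro dvd_diff) auto
    then have "p dvd b * u * (v - x)" by (simp add: algebra_simps)
    then have "p dvd v - x" using p b0[OF that(1,2,4)] nondvd[OF that(1)] by (simp add: prime_dvd_mult_iff)
    moreover have "v \<in> {0<..<p}" "x \<in> {0<..<p}" using that U by blast+
    ultimately show False using \<open>v \<noteq> x\<close> dvd_imp_le_int[of "v - x" p] by auto
  qed
  have "cells_on_line (hyperbola_lift p w C A \<union> hyperbola_lift p w D B) a b c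
      \<subseteq> (\<lambda>(u, i, j). (u + i * p, w u + j * p)) ` Sigma U K"
  proof
    fix z assume "z \<in> cells_on_line (hyperbola_lift p w C A \<union> hyperbola_lift p w D B) a b c"
    then obtain u i j where z: "z = (u + i * p, w u + j * p)" "a * (w u + j * p) - b * (u + i * p) = c"
      and uij: "u \<in> C \<and> (i, j) \<in> A \<or> u \<in> D \<and> (i, j) \<in> B"
      by (auto simp: cells_on_line_def hyperbola_lift_def)
    then have "(i, j) \<in> K u" using CD by (auto simp: K_def S_def)
    moreover from this have "u \<in> U" using uij by (auto simp: U_def)
    ultimately show "z \<in> (\<lambda>(u, i, j). (u + i * p, w u + j * p)) ` Sigma U K"
      using z(1) by force
  qed
  then have "card (cells_on_line (hyperbola_lift p w C A \<union> hyperbola_lift p w D B) a b c)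
      \<le> card (Sigma U K)"
    using finU finK by (intro surj_card_le) auto
  also have "\<dots> = (\<Sum>u\<in>U. card (K u))" using finU finK by (simp add: card_SigmaI)
  also have "\<dots> \<le> 3"
  proof (cases "\<exists>u v. u \<in> U \<and> v \<in> U \<and> u \<noteq> v")
    case True
    then obtain u v where uv: "u \<in> U" "v \<in> U" "u \<noteq> v" by blast
    then have "U = {u, v}" using two by blast
    then show ?thesis using pair[OF uv] uv by simp
  next
    case False
    then have "U = {} \<or> (\<exists>u. U = {u})" by blast
    then show ?thesis using three by auto
  qed
  finally show ?thesis .
qed

section \<open>Size and position of the lifted set\<close>

lemma exists_inverse_mod_prime:
  fixes p :: int
  assumes "prime p" "u \<in> {0<..<p}"
  shows "\<exists>x\<in>{0<..<p}. p dvd u * x - 1"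
proof -
  have p: "1 < p" using assms(1) by (simp add: prime_gt_1_int)
  have "\<not> p dvd u" using assms(2) by (auto dest: zdvd_imp_le)
  then have "coprime u p" using assms(1) by (metis coprime_commute prime_imp_coprime)
  then obtain x where "[u * x = 1] (mod p)" using cong_solve_coprime_int by blast
  then have "[u * (x mod p) = 1] (mod p)" by (simp add: cong_def mod_mult_right_eq)
  then have dvd: "p dvd u * (x mod p) - 1" by (simp add: cong_iff_dvd_diff)
  moreover have "x mod p \<noteq> 0"
  proof
    assume "x mod p = 0"
    then have "p dvd 1" using dvd by simp
    then show False using p by simp
  qed
  moreover have "0 \<le> x mod p" "x mod p < p" using p by simp_all
  ultimately show ?thesis by (intro bexI[of _ "x mod p"]) auto
qed

lemma card_hyperbola_lifts:
  assumes "C \<subseteq> {0<..<p}" "D \<subseteq> {0<..<p}" "C \<inter> D = {}" "finite A" "finite B"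
  shows "card (hyperbola_lift p w C A \<union> hyperbola_lift p w D B) = card C * card A + card D * card B"
proof -
  let ?f = "\<lambda>(u, i, j). (u + i * p, w u + j * p)"
  have inj: "inj_on ?f ({0<..<p} \<times> UNIV)"
  proof (rule inj_onI)
    fix z z' assume z: "z \<in> {0<..<p} \<times> UNIV" "z' \<in> {0<..<p} \<times> UNIV" "?f z = ?f z'"
    obtain u i j u' i' j' where uij: "z = (u, i, j)" "z' = (u', i', j')" by (cases z, cases z')
    have "u + i * p = u' + i' * p" using z by (simp add: uij)
    moreover from this have "(u + i * p) mod p = (u' + i' * p) mod p" by simp
    then have "u = u'" using z by (simp add: uij)
    ultimately show "z = z'" using z by (auto simp: uij)
  qed
  have fin: "finite C" "finite D" using assms finite_subset by blast+
  have "hyperbola_lift p w C A \<union> hyperbola_lift p w D B = ?f ` (C \<times> A \<union> D \<times> B)"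
    by (simp add: hyperbola_lift_def image_Un)
  also have "card \<dots> = card (C \<times> A \<union> D \<times> B)"
    using assms by (intro card_image inj_on_subset[OF inj]) auto
  also have "\<dots> = card (C \<times> A) + card (D \<times> B)"
    using assms fin by (intro card_Un_disjoint) auto
  finally show ?thesis by (simp add: card_cartesian_product)
qed

lemma hyperbola_lift_subset:
  assumes "C \<subseteq> {0<..<p}" "\<And>u. u \<in> {0<..<p} \<Longrightarrow> w u \<in> {0<..<p}"
    and "S \<subseteq> {0..<t} \<times> {0..<t}" "t * p \<le> n"
  shows "hyperbola_lift p w C S \<subseteq> {1..n} \<times> {1..n}"
proof
  fix z assume "z \<in> hyperbola_lift p w C S"
  then obtain u i j where z: "z = (u + i * p, w u + j * p)" "u \<in> C" "(i, j) \<in> S"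
    by (auto simp: hyperbola_lift_def)
  have u: "u \<in> {0<..<p}" "w u \<in> {0<..<p}" using z assms by auto
  have bound: "x + k * p \<in> {1..n}" if "x \<in> {0<..<p}" "k \<in> {0..<t}" for x k
  proof -
    have "0 \<le> k * p" "k * p \<le> (t - 1) * p" using that by (auto intro: mult_right_mono)
    then show ?thesis using that assms(4)
      unfolding atLeastAtMost_iff greaterThanLessThan_iff left_diff_distrib by linarith
  qed
  have "(i, j) \<in> {0..<t} \<times> {0..<t}" using z assms(3) by blast
  then show "z \<in> {1..n} \<times> {1..n}" using bound u z(1) by auto
qed

text \<open>The colour classes may differ in size. The two assignments of \<open>A\<close> and
  \<open>B\<close> to them have \<open>(card C + card D) * (card A + card B)\<close> points in
  total, so the better one has at least half.\<close>

lemma eventually_max_pts_3_ge: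
  fixes t :: nat and \<eta> :: real
  assumes compat: "compatible_patterns (int t) A B" and "0 < \<eta>"
  shows "\<forall>\<^sub>F p in sequentially. prime p \<longrightarrow>
    (\<forall>n\<ge>t * p. (1 - \<eta>) * real p * real (card A + card B) / 2 \<le> real (max_pts 3 n))"
proof (rule eventually_mono[OF eventually_separates_chords[OF assms(2), of t]], intro impI allI)
  fix p n
  assume elim: "prime p \<longrightarrow> (\<exists>C D. separates_chords (int t) (int p) C D \<and>
      (1 - \<eta>) * real p \<le> real (card C + card D))" "prime p" "t * p \<le> n"
  then obtain C D where sep: "separates_chords (int t) (int p) C D"
    and count: "(1 - \<eta>) * real p \<le> real (card C + card D)"
    by blast
  have p: "prime (int p)" using elim by simp
  have "\<forall>u\<in>{0<..<int p}. \<exists>x. x \<in> {0<..<int p} \<and> int p dvd u * x - 1"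
    using exists_inverse_mod_prime[OF p] by blast
  from bchoice[OF this] obtain w
    where w: "\<And>u. u \<in> {0<..<int p} \<Longrightarrow> w u \<in> {0<..<int p} \<and> int p dvd u * w u - 1"
    by blast
  have AB: "A \<subseteq> {0..<int t} \<times> {0..<int t}" "B \<subseteq> {0..<int t} \<times> {0..<int t}"
    using compat by (auto simp only: compatible_patterns_def)
  then have fin: "finite A" "finite B" using finite_subset by blast+
  have tp: "int t * int p \<le> int n" using elim(3) by (metis of_nat_le_iff of_nat_mult)
  have main: "card C' * card A + card D' * card B \<le> max_pts 3 n"
    if sep': "separates_chords (int t) (int p) C' D'" for C' D'
  proof -
    have sub: "C' \<subseteq> {0<..<int p}" "D' \<subseteq> {0<..<int p}" "C' \<inter> D' = {}"
      using sep' by (auto simp only: separates_chords_def)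
    have "card (hyperbola_lift (int p) w C' A \<union> hyperbola_lift (int p) w D' B) \<le> max_pts 3 n"
    proof (rule le_max_ptsI)
      show "hyperbola_lift (int p) w C' A \<union> hyperbola_lift (int p) w D' B \<subseteq> {1..int n} \<times> {1..int n}"
        using w by (intro Un_least hyperbola_lift_subset[OF sub(1) _ AB(1) tp]
          hyperbola_lift_subset[OF sub(2) _ AB(2) tp]) simp_all
      show "card (cells_on_line (hyperbola_lift (int p) w C' A \<union> hyperbola_lift (int p) w D' B) a b c) \<le> 3"
        if "coprime a b" "0 < a \<or> a = 0 \<and> b = 1" for a b c
        by (rule card_hyperbola_lifts_on_line[OF p sep' w compat that])
    qed simp
    then show ?thesis unfolding card_hyperbola_lifts[OF sub fin] .
  qed
  have "(card C + card D) * (card A + card B) \<le> 2 * max_pts 3 n"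
    using main[OF sep] main[OF sep[THEN separates_chords_commute[THEN iffD1]]] by (simp add: algebra_simps)
  then have "real ((card C + card D) * (card A + card B)) \<le> real (2 * max_pts 3 n)"
    by (simp only: of_nat_le_iff)
  then have "real (card C + card D) * real (card A + card B) \<le> 2 * real (max_pts 3 n)"
    by (simp only: of_nat_mult of_nat_numeral)
  moreover have "(1 - \<eta>) * real p * real (card A + card B) \<le> real (card C + card D) * real (card A + card B)"
    using count by (intro mult_right_mono) auto
  ultimately show "(1 - \<eta>) * real p * real (card A + card B) / 2 \<le> real (max_pts 3 n)" by linarith
qed

section \<open>Patterns\<close>

fun repeats :: "'a list \<Rightarrow> 'a list" where
  "repeats [] = []"
| "repeats (x # xs) = (if x \<in> set xs then x # repeats xs else repeats xs)"

lemma mem_set_iff_count_list: "x \<in> set xs \<longleftrightarrow> 1 \<le> count_list xs x"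
  using count_list_0_iff[of xs x] by linarith

lemma count_list_repeats: "count_list (repeats xs) x = count_list xs x - 1"
proof (induction xs)
  case (Cons a xs)
  have "a \<in> set xs \<Longrightarrow> 1 \<le> count_list xs a" by (simp only: mem_set_iff_count_list)
  moreover have "a \<notin> set xs \<Longrightarrow> count_list xs a = 0" by simp
  ultimately show ?case using Cons by auto
qed simp

fun far :: "int \<Rightarrow> int \<Rightarrow> int list \<Rightarrow> bool" where
  "far d x [] \<longleftrightarrow> True"
| "far d x (y # ys) \<longleftrightarrow> (d < x - y \<or> d < y - x) \<and> far d x ys"

fun apart :: "int \<Rightarrow> int list \<Rightarrow> int list \<Rightarrow> bool" where
  "apart d [] ys \<longleftrightarrow> True"
| "apart d (x # xs) ys \<longleftrightarrow> far d x ys \<and> apart d xs ys"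

lemma apart_iff: "apart d xs ys \<longleftrightarrow> (\<forall>x\<in>set xs. \<forall>y\<in>set ys. d < \<bar>x - y\<bar>)"
proof -
  have far: "far d x ys \<longleftrightarrow> (\<forall>y\<in>set ys. d < \<bar>x - y\<bar>)" for x
  proof (induction ys)
    case (Cons y ys)
    have "d < x - y \<or> d < y - x \<longleftrightarrow> d < \<bar>x - y\<bar>" by linarith
    then show ?case using Cons by simp
  qed simp
  show ?thesis by (induction xs) (simp_all add: far)
qed

lemma apartD: "apart d xs ys \<Longrightarrow> \<bar>x - y\<bar> \<le> d \<Longrightarrow> x \<in> set xs \<Longrightarrow> y \<notin> set ys"
  unfolding apart_iff by (meson not_le)

text \<open>
  \<open>repeats\<close> lowers every multiplicity by one, so the elements of \<open>xs2\<close> and \<open>xs3\<close> are those that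
  occur at least twice and at least three times in \<open>xs\<close>.  The intermediate lists are arguments rather than
  \<open>let\<close>-bound so that the simplifier evaluates them only once.
\<close>

definition triples_apart :: "int \<Rightarrow> int list \<Rightarrow> int list \<Rightarrow> int list \<Rightarrow> int list \<Rightarrow> bool" where
  "triples_apart d xs ys xs3 ys3 \<longleftrightarrow>
    apart d xs3 ys \<and> apart d xs ys3 \<and> repeats xs3 = [] \<and> repeats ys3 = []"

definition pairs_apart :: "int \<Rightarrow> int list \<Rightarrow> int list \<Rightarrow> int list \<Rightarrow> int list \<Rightarrow> bool" where
  "pairs_apart d xs ys xs2 ys2 \<longleftrightarrow>
    apart d xs2 ys2 \<and> triples_apart d xs ys (repeats xs2) (repeats ys2)"

definition sums_le_3 :: "int \<Rightarrow> int list \<Rightarrow> int list \<Rightarrow> bool" where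
  "sums_le_3 d xs ys \<longleftrightarrow> pairs_apart d xs ys (repeats xs) (repeats ys)"

text \<open>With both multiplicities at most 3, a sum above 3 needs at least (2, 2), (3, 1) or (1,
  3); each case is excluded by one of the \<open>apart\<close> conditions.\<close>

lemma count_list_sum_le_3:
  assumes "sums_le_3 d xs ys" "\<bar>x - y\<bar> \<le> d"
  shows "count_list xs x + count_list ys y \<le> 3"
proof -
  let ?m = "count_list xs x" and ?n = "count_list ys y"
  have *: "apart d (repeats xs) (repeats ys)" "apart d (repeats (repeats xs)) ys"
    "apart d xs (repeats (repeats ys))" "repeats (repeats (repeats xs)) = []"
    "repeats (repeats (repeats ys)) = []"
    using assms(1) by (auto simp: sums_le_3_def pairs_apart_def triples_apart_def)
  have "?m \<le> 3" "?n \<le> 3"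
    using arg_cong[OF *(4), of "\<lambda>l. count_list l x"] arg_cong[OF *(5), of "\<lambda>l. count_list l y"]
    by (simp_all add: count_list_repeats)
  moreover have
    "2 \<le> ?m \<Longrightarrow> x \<in> set (repeats xs)" "2 \<le> ?n \<Longrightarrow> y \<in> set (repeats ys)"
    "3 \<le> ?m \<Longrightarrow> x \<in> set (repeats (repeats xs))" "3 \<le> ?n \<Longrightarrow> y \<in> set (repeats (repeats ys))"
    "1 \<le> ?m \<Longrightarrow> x \<in> set xs" "1 \<le> ?n \<Longrightarrow> y \<in> set ys"
    unfolding mem_set_iff_count_list count_list_repeats by linarith+
  then have "\<not> (2 \<le> ?m \<and> 2 \<le> ?n)" "\<not> (3 \<le> ?m \<and> 1 \<le> ?n)" "\<not> (1 \<le> ?m \<and> 3 \<le> ?n)"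
    using apartD[OF *(1) assms(2)] apartD[OF *(2) assms(2)] apartD[OF *(3) assms(2)] by blast+
  ultimately show ?thesis by linarith
qed

definition line_offsets :: "int \<Rightarrow> int \<Rightarrow> (int \<times> int) list \<Rightarrow> int list" where
  "line_offsets a b xs = map (\<lambda>(i, j). a * j - b * i) xs"

lemma card_cells_on_line_set:
  "distinct xs \<Longrightarrow> card (cells_on_line (set xs) a b e) = count_list (line_offsets a b xs) e"
proof (induction xs)
  case Nil
  then show ?case by (simp add: cells_on_line_def line_offsets_def)
next
  case (Cons z xs)
  have "cells_on_line (set (z # xs)) a b e
      = (if a * snd z - b * fst z = e then {z} else {}) \<union> cells_on_line (set xs) a b e"
    by (auto simp: cells_on_line_def)
  moreover have "finite (cells_on_line (set xs) a b e)"
    by (auto simp: cells_on_line_def intro: finite_subset[of _ "set xs"])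
  moreover have "z \<notin> cells_on_line (set xs) a b e"
    using Cons.prems by (auto simp: cells_on_line_def)
  ultimately show ?case using Cons
    by (auto simp: line_offsets_def case_prod_unfold)
qed

definition directions :: "int \<Rightarrow> (int \<times> int) list" where
  "directions t = concat (map (\<lambda>a. concat (map (\<lambda>b.
     if gcd a b = 1 then [(a, b), (a, - b)] else []) [1..t - 1])) [1..t - 1])"

lemma mem_directions:
  assumes "a \<in> set [1..t - 1]" "b \<in> set [1..t - 1]" "gcd a b = 1"
  shows "(a, b) \<in> set (directions t)" "(a, - b) \<in> set (directions t)"
  using assms unfolding directions_def by force+

fun directions_ok :: "(int \<times> int) list \<Rightarrow> (int \<times> int) list \<Rightarrow> (int \<times> int) list \<Rightarrow> bool" where
  "directions_ok xs ys [] \<longleftrightarrow> True"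
| "directions_ok xs ys ((a, b) # ds) \<longleftrightarrow>
    sums_le_3 (a + \<bar>b\<bar> - 2) (line_offsets a b xs) (line_offsets a b ys) \<and> directions_ok xs ys ds"

lemma directions_okD:
  "directions_ok xs ys ds \<Longrightarrow> (a, b) \<in> set ds \<Longrightarrow>
    sums_le_3 (a + \<bar>b\<bar> - 2) (line_offsets a b xs) (line_offsets a b ys)"
  by (induction ds rule: directions_ok.induct) auto

text \<open>The size condition is \<open>(\<bar>A\<bar> + \<bar>B\<bar>) / 2 \<ge> 1.975 (t + 1)\<close>.\<close>

definition pattern_ok :: "int \<Rightarrow> (int \<times> int) list \<Rightarrow> (int \<times> int) list \<Rightarrow> bool" where
  "pattern_ok t xs ys \<longleftrightarrow>
    distinct xs \<and> distinct ys \<and>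
    list_all (\<lambda>(i, j). 0 \<le> i \<and> i < t \<and> 0 \<le> j \<and> j < t) (xs @ ys) \<and>
    79 * (t + 1) \<le> 20 * int (length xs + length ys) \<and>
    list_all (\<lambda>zs. repeats (repeats (repeats zs)) = [])
      [line_offsets 1 0 xs, line_offsets 0 1 xs, line_offsets 1 0 ys, line_offsets 0 1 ys] \<and>
    directions_ok xs ys (directions t)"

text \<open>Cells on a line are counted by the multiplicity of its offset, so finitely many list
  checks cover all \<open>e\<close> and \<open>f\<close>.\<close>

lemma compatible_patterns_if_pattern_ok:
  assumes "pattern_ok t xs ys"
  shows "compatible_patterns t (set xs) (set ys)"
proof -
  have dist: "distinct xs" "distinct ys"
    and box: "list_all (\<lambda>(i, j). 0 \<le> i \<and> i < t \<and> 0 \<le> j \<and> j < t) (xs @ ys)"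
    and lines: "list_all (\<lambda>zs. repeats (repeats (repeats zs)) = [])
      [line_offsets 1 0 xs, line_offsets 0 1 xs, line_offsets 1 0 ys, line_offsets 0 1 ys]"
    and dirs: "directions_ok xs ys (directions t)"
    using assms by (simp_all only: pattern_ok_def)
  note card = card_cells_on_line_set[OF dist(1)] card_cells_on_line_set[OF dist(2)]
  have "count_list zs e \<le> 3" if "repeats (repeats (repeats zs)) = []" for zs :: "int list" and e
    using arg_cong[OF that, of "\<lambda>l. count_list l e"] by (simp add: count_list_repeats)
  then have axis: "count_list (line_offsets 1 0 xs) e \<le> 3" "count_list (line_offsets 0 1 xs) e \<le> 3"
    "count_list (line_offsets 1 0 ys) e \<le> 3" "count_list (line_offsets 0 1 ys) e \<le> 3" for e
    using lines by simp_all
  have "card (cells_on_line (set xs) a b e) + card (cells_on_line (set ys) a b f) \<le> 3"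
    if "coprime a b" "0 < a" "a < t" "b \<noteq> 0" "\<bar>b\<bar> < t" "\<bar>e - f\<bar> \<le> a + \<bar>b\<bar> - 2" for a b e f
  proof -
    have "(a, b) \<in> set (directions t)"
    proof (cases "0 < b")
      case True
      then show ?thesis using that by (intro mem_directions) (auto intro: coprime_imp_gcd_eq_1)
    next
      case False
      then have "(a, - (- b)) \<in> set (directions t)"
        using that by (intro mem_directions) (auto intro: coprime_imp_gcd_eq_1)
      then show ?thesis by simp
    qed
    then have "sums_le_3 (a + \<bar>b\<bar> - 2) (line_offsets a b xs) (line_offsets a b ys)"
      by (rule directions_okD[OF dirs])
    then show ?thesis using that(6) unfolding card by (rule count_list_sum_le_3)
  qed
  moreover have "\<forall>S\<in>{set xs, set ys}. \<forall>e. card (cells_on_line S 1 0 e) \<le> 3 \<and> card (cells_on_line S 0 1 e) \<le> 3"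
    unfolding ball_simps card using axis by (intro conjI allI TrueI)
  moreover have "set xs \<subseteq> {0..<t} \<times> {0..<t}" "set ys \<subseteq> {0..<t} \<times> {0..<t}"
  proof -
    have in_box: "z \<in> {0..<t} \<times> {0..<t}" if "z \<in> set (xs @ ys)" for z
      using bspec[OF box[unfolded list_all_iff] that] by (cases z) auto
    show "set xs \<subseteq> {0..<t} \<times> {0..<t}" by (intro subsetI in_box) simp
    show "set ys \<subseteq> {0..<t} \<times> {0..<t}" by (intro subsetI in_box) simp
  qed
  ultimately show ?thesis unfolding compatible_patterns_def by (intro conjI allI impI)
qed

text \<open>
  Row \<open>j\<close> of a pattern is given by the list of the columns of its cells.  The patterns were found by
  simulated annealing.
\<close>

definition pattern_cells :: "int list list \<Rightarrow> (int \<times> int) list" where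
  "pattern_cells css = concat (map (\<lambda>(j, cs). map (\<lambda>i. (i, j)) cs) (zip [0..int (length css) - 1] css))"

text \<open>The two patterns have 21 + 19 = 40 cells; the size condition asks for at least
  39.5.\<close>

lemma pattern_ok_9:
  "pattern_ok 9
    (pattern_cells
      [[2, 5, 8], [0, 1, 2], [0, 1, 2], [], [0], [6, 7, 8], [7, 8], [4, 5, 7], [4, 5, 6]])
    (pattern_cells
      [[3, 4, 5], [4, 5, 7], [8], [7, 8], [], [1, 2, 4], [0, 1], [0, 2], [0, 1, 2]])"
  by code_simp

lemma pattern_ok_10:
  "pattern_ok 10
    (pattern_cells
      [[4, 5, 7], [4, 7, 8], [9], [7, 8, 9], [9], [0], [], [0, 1, 2], [0, 1, 2], [1, 3, 8]])
    (pattern_cells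
      [[1, 2, 3], [0, 1, 2], [0], [1, 3], [0, 2, 3], [9], [8, 9], [4, 8, 9], [4, 5, 8], [4, 5,
      6]])"
  by code_simp

lemma pattern_ok_11:
  "pattern_ok 11
    (pattern_cells
      [[1, 2, 3], [1, 2], [0, 2, 3], [], [0], [0], [9, 10], [6, 9, 10], [7, 10], [7, 8, 9], [7,
      8]])
    (pattern_cells
      [[5, 7, 8], [6, 7, 8], [6, 10], [0, 9, 10], [8, 9, 10], [], [0, 3], [0, 3], [1, 2, 3], [1,
      2, 5], [1, 4, 5]])"
  by code_simp

lemma pattern_ok_12:
  "pattern_ok 12
    (pattern_cells
      [[2, 5, 6], [2, 4, 5], [0, 1, 5], [0, 1, 2], [0], [], [], [11], [9, 10, 11], [10, 11], [7,
      9, 10], [6, 7, 9]])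
    (pattern_cells
      [[8, 9, 10], [], [8, 9, 11], [10], [4, 8, 11], [10, 11], [0, 1, 2], [0, 4, 7], [1, 3], [0,
      1, 3], [2], [2, 3, 4]])"
  by code_simp

lemma pattern_ok_13:
  "pattern_ok 13
    (pattern_cells
      [[6, 7, 10], [6, 7, 10], [7, 10], [5, 11, 12], [11, 12], [11, 12], [], [4, 5], [0, 1, 5],
      [0, 4], [0, 1, 3], [1, 3], [2, 3, 4]])
    (pattern_cells
      [[2, 3, 4], [1, 2, 3], [0, 1, 3], [], [0], [0, 1, 2], [], [10, 11, 12], [12], [12], [9,
      10, 11], [9, 10, 11], [5, 6, 7]])"
  by code_simp

lemma pattern_ok_14:
  "pattern_ok 14
    (pattern_cells
      [[5, 6, 7], [2, 5, 7], [2, 5], [0, 1, 2], [0, 6, 9], [0, 1, 3], [], [10, 11, 13], [9, 12,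
      13], [], [12], [10, 11, 13], [11, 12], [9, 10]])
    (pattern_cells
      [[9, 10, 11], [9, 11, 12], [9, 13], [12, 13], [11, 12], [13], [], [0], [0, 1, 6], [0, 3],
      [1, 7], [1, 2, 3], [2, 6, 7], [3, 6, 7]])"
  by code_simp

lemma exists_pattern:
  assumes "t \<in> {9..14::nat}"
  shows "\<exists>A B. compatible_patterns (int t) A B \<and> 79 * (t + 1) \<le> 20 * (card A + card B)"
proof -
  have "\<exists>xs ys. pattern_ok (int t) xs ys"
  proof -
    from assms consider "t = 9" | "t = 10" | "t = 11" | "t = 12" | "t = 13" | "t = 14" by force
    then show ?thesis
      by cases (auto intro: pattern_ok_9 pattern_ok_10 pattern_ok_11 pattern_ok_12 pattern_ok_13 pattern_ok_14)
  qed
  then obtain xs ys where ok: "pattern_ok (int t) xs ys" by blast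
  then have "distinct xs" "distinct ys" "79 * (int t + 1) \<le> 20 * int (length xs + length ys)"
    unfolding pattern_ok_def by blast+
  then have "79 * (t + 1) \<le> 20 * (card (set xs) + card (set ys))"
    by (simp add: distinct_card)
  then show ?thesis using compatible_patterns_if_pattern_ok[OF ok] by blast
qed

section \<open>Choice of the prime and of the number of blocks\<close>

theorem theorem1p6:
  shows "\<exists>N. \<forall>n\<ge>N. real (max_pts 3 n) \<ge> 1.973 * real n"
proof -
  have "\<forall>\<^sub>F p in sequentially. prime p \<longrightarrow>
      (\<forall>n\<ge>t * p. 1.973 * (real t + 1) * real p \<le> real (max_pts 3 n))" if "t \<in> {9..14}" for t
  proof -
    obtain A B where AB: "compatible_patterns (int t) A B" "79 * (t + 1) \<le> 20 * (card A + card B)"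
      using exists_pattern[OF \<open>t \<in> {9..14}\<close>] by blast
    have "1.975 * (real t + 1) \<le> real (card A + card B) / 2" using AB(2) by simp
    \<comment> \<open>The loss is affordable: 1.975 * (1 - 1/2000) = 1.9740125 exceeds
      1.973.\<close>
    then have "(1 - 1 / 2000) * (1.975 * (real t + 1)) \<le> (1 - 1 / 2000) * (real (card A + card B) / 2)"
      by (intro mult_left_mono) auto
    then have "1.973 * (real t + 1) \<le> (1 - 1 / 2000) * (real (card A + card B) / 2)" by simp
    then have le: "1.973 * (real t + 1) * real p \<le> (1 - 1 / 2000) * real p * real (card A + card B) / 2" for p
      using mult_right_mono[of _ _ "real p"] by (fastforce simp: ac_simps)
    have "(0::real) < 1 / 2000" by simp
    from eventually_max_pts_3_ge[OF AB(1) this] show ?thesis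
      by eventually_elim (use le in \<open>meson order_trans\<close>)
  qed
  then have "\<forall>\<^sub>F p in sequentially. \<forall>t\<in>{9..14}. prime p \<longrightarrow>
      (\<forall>n\<ge>t * p. 1.973 * (real t + 1) * real p \<le> real (max_pts 3 n))"
    by (intro eventually_ball_finite) auto
  then obtain P where P: "\<And>p t n. P \<le> p \<Longrightarrow> t \<in> {9..14} \<Longrightarrow> prime p \<Longrightarrow> t * p \<le> n \<Longrightarrow>
      1.973 * (real t + 1) * real p \<le> real (max_pts 3 n)"
    unfolding eventually_sequentially by blast
  obtain X where X: "\<And>x::nat. X \<le> x \<Longrightarrow> \<exists>p. prime p \<and> 5 * x < 8 * p \<and> p \<le> x"
    using eventually_prime_between unfolding eventually_sequentially by blast
  have "1.973 * real n \<le> real (max_pts 3 n)" if n: "9 * (X + 2 * P + 20) \<le> n" for n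
  proof -
    \<comment> \<open>\<open>p \<le> x\<close> gives \<open>9 * p \<le> n\<close>, and
      \<open>p > 5 * x / 8\<close> gives \<open>15 * p > 9.375 * x\<close>, which exceeds
      \<open>n\<close> since \<open>x \<ge> 20\<close> absorbs the rounding. Hence
      \<open>n div p\<close> is in 9..14; the summand \<open>2 * P\<close> ensures
      \<open>P \<le> p\<close>.\<close>
    define x where "x = n div 9"
    have x: "X + 2 * P + 20 \<le> x" "9 * x \<le> n" "n < 9 * x + 9" using n by (auto simp: x_def)
    obtain p where p: "prime p" "5 * x < 8 * p" "p \<le> x" using X[of x] x by auto
    define t where "t = n div p"
    have p0: "0 < p" "P \<le> p" using p x by auto
    have "9 * p \<le> n" "n < 15 * p" using p x by auto
    then have "9 \<le> t" "t < 15"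
      using p0 by (simp_all add: t_def less_eq_div_iff_mult_less_eq div_less_iff_less_mult)
    then have t: "t \<in> {9..14}" by simp
    have "t * p \<le> n" "n < (t + 1) * p"
      using p0 dividend_less_div_times[of p n] by (auto simp: t_def add.commute)
    then have "real n \<le> (real t + 1) * real p"
      by (metis less_imp_le of_nat_1 of_nat_add of_nat_le_iff of_nat_mult)
    then have "1.973 * real n \<le> 1.973 * ((real t + 1) * real p)" by simp
    also have "\<dots> = 1.973 * (real t + 1) * real p" by simp
    also have "\<dots> \<le> real (max_pts 3 n)" by (rule P[OF p0(2) t p(1) \<open>t * p \<le> n\<close>])
    finally show ?thesis .
  qed
  then show ?thesis by blast
qed

end
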